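(* There exists a universal constant $C>0$ such that the following holds. Let $n_1,n_2,p,m\in\mathbb{N}^+$, $\mathbf{A}\in\mathbb{R}^{n_1n_2\times p}$, $\mathbf{b}\in\mathbb{R}^{n_1n_2}$, and let $\mathbf{x}^*\in\arg\min_{\mathbf{x}\in\mathbb{R}^p}\|\mathbf{A}\mathbf{x}-\mathbf{b}\|_2^2$. Fix $\varepsilon\in(0,1)$ and $\delta\in(0,1/2)$. Let $\mathbf{S}\in\mathbb{R}^{m\times n_1n_2}$ be a random matrix whose rows are independent and each of the form $\boldsymbol{\eta}^\top\otimes\boldsymbol{\xi}^\top$, where $\boldsymbol{\eta}\in\{-1,1\}^{n_1}$ and $\boldsymbol{\xi}\in\{-1,1\}^{n_2}$ are independent Rademacher vectors. If $$m\ \ge\ C\,\max\left(\frac{\mathrm{rank}^2(\mathbf{A})+\log^2(1/\delta)}{\varepsilon},\ \frac{\mathrm{rank}(\mathbf{A})+\log(1/\delta)}{\varepsilon^2}\right),$$ then, with probability exceeding $1-\delta$, the sketched solution $\hat{\mathbf{x}}\in\arg\min_{\mathbf{x}\in\mathbb{R}^p}\|(\mathbf{S}\mathbf{A})\mathbf{x}-\mathbf{S}\mathbf{b}\|_2^2$ satisfies $$\|\mathbf{A}\hat{\mathbf{x}}-\mathbf{b}\|_2^2\le(1+\varepsilon)^2\,\|\mathbf{A}\mathbf{x}^*-\mathbf{b}\|_2^2 .$$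
   Context: A random Rademacher vector has i.i.d. entries taking the values $-1$ and $1$ with probability $1/2$ each. $\otimes$ is the Kronecker product. $\mathrm{rank}^2(\mathbf{A})=(\mathrm{rank}(\mathbf{A}))^2$ and $\log^2 t=(\log t)^2$. A constant is universal if it does not depend on any other parameter. *)

theory Defs
  imports
    "HOL-Probability.Product_PMF"
    "Jordan_Normal_Form.DL_Rank"
begin

text \<open>
  All dimensions are explicit natural numbers because the constant in the theorem must be chosen
  before them.  Vectors and matrices are therefore those of Jordan_Normal_Form; the fixed-size
  types and constants of HOL-Analysis with the same names are hidden.
\<close>

hide_type (open) Finite_Cartesian_Product.vec
hide_const (open) Finite_Cartesian_Product.vec Finite_Cartesian_Product.row
  Finite_Cartesian_Product.mat
no_notation vec_nth (infixl \<open>$\<close> 90)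

definition vec_norm2 :: "real vec \<Rightarrow> real" where
  "vec_norm2 v = L2_set (\<lambda>i. v $ i) {..<dim_vec v}"

definition kronecker_product :: "'a::times mat \<Rightarrow> 'a mat \<Rightarrow> 'a mat"  (infixl \<open>\<otimes>\<^sub>K\<close> 70)
  where
  "A \<otimes>\<^sub>K B = Matrix.mat (dim_row A * dim_row B) (dim_col A * dim_col B)
     (\<lambda>(i, j). A $$ (i div dim_row B, j div dim_col B) * B $$ (i mod dim_row B, j mod dim_col B))"

text \<open>
  In \<open>Pi_pmf\<close> the second argument is a dummy value taken outside the index set;
  it is discarded when the vector or matrix is built.
\<close>

definition rademacher_vec_pmf :: "nat \<Rightarrow> real vec pmf" where
  "rademacher_vec_pmf n =
     map_pmf (\<lambda>f. Matrix.vec n f) (Pi_pmf {..<n} 0 (\<lambda>_. pmf_of_set {-1, 1}))"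

text \<open>The law of one row \<open>\<eta>\<^sup>T \<otimes> \<xi>\<^sup>T\<close> of the sketching matrix.\<close>

definition kronecker_row_pmf :: "nat \<Rightarrow> nat \<Rightarrow> real vec pmf" where
  "kronecker_row_pmf n1 n2 =
     map_pmf (\<lambda>(\<eta>, \<xi>). Matrix.row (mat_of_row \<eta> \<otimes>\<^sub>K mat_of_row \<xi>) 0)
       (pair_pmf (rademacher_vec_pmf n1) (rademacher_vec_pmf n2))"

text \<open>
  The law of the random \<open>m \<times> n1 n2\<close> matrix with independent rows of that form.  The
  assumptions on the random matrix determine its law, and only the law enters a statement about
  the probability of an event defined by the matrix.
\<close>

definition kronecker_sketch_pmf :: "nat \<Rightarrow> nat \<Rightarrow> nat \<Rightarrow> real mat pmf" where
  "kronecker_sketch_pmf m n1 n2 =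
     map_pmf (\<lambda>r. mat_of_rows (n1 * n2) (map r [0..<m]))
       (Pi_pmf {..<m} (0\<^sub>v (n1 * n2)) (\<lambda>_. kronecker_row_pmf n1 n2))"

definition least_squares_solution :: "nat \<Rightarrow> real mat \<Rightarrow> real vec \<Rightarrow> real vec \<Rightarrow> bool" where
  "least_squares_solution p A b x \<longleftrightarrow>
     is_arg_min (\<lambda>y. (vec_norm2 (A *\<^sub>v y - b))\<^sup>2) (\<lambda>y. y \<in> carrier_vec p) x"

end

theory Submission
  imports Defs
begin

text \<open>
  All residuals \<open>A x - b\<close> lie in one subspace \<open>V\<close>, the span of \<open>b\<close> and the columns of \<open>A\<close>, of
  dimension \<open>d \<le> rank A + 1\<close>.  If \<open>\<parallel>S v\<parallel>\<^sup>2\<close> agrees with \<open>m \<parallel>v\<parallel>\<^sup>2\<close> up to the factor \<open>1 \<plusminus> \<epsilon> / 2\<close> for all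
  \<open>v\<close> in \<open>V\<close>, then minimising the sketched residual instead of the residual costs at most the factor
  \<open>(1 + \<epsilon> / 2) / (1 - \<epsilon> / 2) \<le> (1 + \<epsilon>)\<^sup>2\<close> (\<open>least_squares_of_embedding\<close>).  So it suffices that \<open>S\<close> embeds
  \<open>V\<close> almost isometrically with probability more than \<open>1 - \<delta>\<close>.

  For a fixed unit vector \<open>v\<close> the inner product of \<open>v\<close> with a row is a bilinear form \<open>X = \<eta>\<^sup>T M \<xi>\<close>, where
  \<open>M\<close> is \<open>v\<close> rearranged as an \<open>n1 \<times> n2\<close> matrix of Frobenius norm 1.  It has second moment 1 and is
  subexponential: \<open>E (exp (\<bar>X\<bar> / 2)) \<le> 3\<close> (\<open>chaos_exp_abs_moment\<close>).  Then \<open>\<parallel>S v\<parallel>\<^sup>2\<close> is a sum of \<open>m\<close> independent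
  squares of subexponential variables, and it deviates from \<open>m\<close> by more than \<open>m \<epsilon>\<close> with a probability
  at most of order \<open>exp (- c min (m \<epsilon>\<^sup>2) (sqrt (m \<epsilon>)))\<close> for a constant \<open>c > 0\<close>.  This is at most a multiple of
  \<open>exp (- k)\<close> as soon as \<open>m \<epsilon>\<^sup>2\<close> exceeds a multiple of \<open>k\<close> and \<open>m \<epsilon>\<close> exceeds a multiple of \<open>k\<^sup>2\<close>
  (\<open>sum_squares_concentration\<close>, proved by truncation and Chernoff's bound).

  The step from single vectors to \<open>V\<close> is a net argument in orthonormal coordinates.  A scaled piece
  of the integer lattice with at most \<open>192\<^sup>d\<close> points controls the quadratic form
  \<open>\<parallel>S v\<parallel>\<^sup>2 - m \<parallel>v\<parallel>\<^sup>2\<close> on \<open>V\<close> up to a factor 2 (\<open>quadratic_form_le_of_grid\<close>); counting lattice points by a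
  product formula replaces the usual volume comparison.  The union bound over the net then asks for
  \<open>k\<close> of order \<open>rank A + ln (1 / \<delta>)\<close>, and the two conditions on \<open>m\<close> become the two terms of the maximum.
\<close>

section \<open>Rademacher sums\<close>

text \<open>
  Sign vectors are handled as functions on a finite index set, so that expectations can be computed
  by induction on that set.
\<close>
abbreviation rademacher :: "'i set \<Rightarrow> ('i \<Rightarrow> real) pmf" where
  "rademacher A \<equiv> Pi_pmf A 0 (\<lambda>_. pmf_of_set {-1, 1})"

lemma expectation_pair_pmf_finite:
  fixes f :: "'a \<times> 'b \<Rightarrow> real"
  assumes "finite (set_pmf p)" "finite (set_pmf q)"
  shows "measure_pmf.expectation (pair_pmf p q) f =
           measure_pmf.expectation p (\<lambda>x. measure_pmf.expectation q (\<lambda>y. f (x, y)))"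
proof -
  have "measure_pmf.expectation (pair_pmf p q) f =
      (\<Sum>z\<in>set_pmf p \<times> set_pmf q. f z * pmf (pair_pmf p q) z)"
    using assms by (intro integral_measure_pmf_real) auto
  also have "\<dots> = (\<Sum>x\<in>set_pmf p. (\<Sum>y\<in>set_pmf q. f (x, y) * pmf q y) * pmf p x)"
    unfolding sum.cartesian_product[symmetric] sum_distrib_right
    by (auto intro!: sum.cong simp: pmf_pair sum.cartesian_product split_beta mult_ac)
  also have "\<dots> = (\<Sum>x\<in>set_pmf p. measure_pmf.expectation q (\<lambda>y. f (x, y)) * pmf p x)"
    using assms by (intro sum.cong refl) (simp add: integral_measure_pmf_real[of "set_pmf q"])
  also have "\<dots> = measure_pmf.expectation p (\<lambda>x. measure_pmf.expectation q (\<lambda>y. f (x, y)))"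
    using assms by (simp add: integral_measure_pmf_real[of "set_pmf p"])
  finally show ?thesis .
qed

lemma finite_set_Pi_pmf:
  assumes "finite A" "\<And>x. x \<in> A \<Longrightarrow> finite (set_pmf (p x))"
  shows "finite (set_pmf (Pi_pmf A d p))"
  using assms by (auto simp: set_Pi_pmf)

lemma finite_set_rademacher: "finite A \<Longrightarrow> finite (set_pmf (rademacher A))"
  by (intro finite_set_Pi_pmf) auto

lemma expectation_mono_finite:
  fixes f g :: "'a \<Rightarrow> real"
  assumes "finite (set_pmf p)" "\<And>x. x \<in> set_pmf p \<Longrightarrow> f x \<le> g x"
  shows "measure_pmf.expectation p f \<le> measure_pmf.expectation p g"
  using assms
  by (intro integral_mono_AE integrable_measure_pmf_finite) (auto simp: AE_measure_pmf_iff)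

lemma expectation_rademacher_insert:
  fixes F :: "('i \<Rightarrow> real) \<Rightarrow> real"
  assumes "finite A" "a \<notin> A"
  shows "measure_pmf.expectation (rademacher (insert a A)) F =
     (measure_pmf.expectation (rademacher A) (\<lambda>f. F (f(a := 1))) +
      measure_pmf.expectation (rademacher A) (\<lambda>f. F (f(a := -1)))) / 2"
proof -
  have "measure_pmf.expectation (rademacher (insert a A)) F =
    measure_pmf.expectation (pair_pmf (pmf_of_set {-1, 1}) (rademacher A)) (\<lambda>(y, f). F (f(a := y)))"
    using assms by (simp add: Pi_pmf_insert case_prod_unfold)
  also have "\<dots> = measure_pmf.expectation (pmf_of_set {-1, 1})
      (\<lambda>y. measure_pmf.expectation (rademacher A) (\<lambda>f. F (f(a := y))))"
    using assms finite_set_rademacher[of A] by (subst expectation_pair_pmf_finite) auto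
  also have "\<dots> = (measure_pmf.expectation (rademacher A) (\<lambda>f. F (f(a := 1))) +
      measure_pmf.expectation (rademacher A) (\<lambda>f. F (f(a := -1)))) / 2"
    by (subst integral_pmf_of_set) auto
  finally show ?thesis .
qed

lemma sum_fun_upd_notin:
  fixes f w :: "'i \<Rightarrow> real"
  assumes "finite A" "a \<notin> A"
  shows "(\<Sum>i\<in>insert a A. (f(a := y)) i * w i) = y * w a + (\<Sum>i\<in>A. f i * w i)"
proof -
  have "(\<Sum>i\<in>A. (f(a := y)) i * w i) = (\<Sum>i\<in>A. f i * w i)"
    using assms by (intro sum.cong) auto
  then show ?thesis using assms by simp
qed

lemma two_power_fact_le: "2 ^ k * fact k \<le> (fact (2 * k) :: real)"
proof (induction k)
  case (Suc k)
  have "2 ^ Suc k * fact (Suc k) = (2 * real k + 2) * (2 ^ k * fact k)"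
    by (simp add: algebra_simps)
  also have "\<dots> \<le> (2 * real k + 2) * ((2 * real k + 1) * fact (2 * k))"
  proof (intro mult_left_mono)
    note Suc
    also have "fact (2 * k) = 1 * (fact (2 * k) :: real)" by simp
    also have "\<dots> \<le> (2 * real k + 1) * fact (2 * k)" by (intro mult_right_mono) auto
    finally show "2 ^ k * fact k \<le> (2 * real k + 1) * fact (2 * k)" .
  qed simp
  also have "\<dots> = fact (2 * Suc k)" by (simp add: algebra_simps)
  finally show ?case .
qed simp

text \<open>
  Termwise comparison of the power series, by \<open>2\<^sup>k k! \<le> (2k)!\<close>.
\<close>
lemma cosh_le_exp_half_square: "(exp x + exp (- x)) / 2 \<le> exp (x\<^sup>2 / 2)" for x :: real
proof -
  have "(\<lambda>k. (x\<^sup>2 / 2) ^ k / fact k) sums exp (x\<^sup>2 / 2)"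
    using exp_converges[of "x\<^sup>2 / 2"] unfolding real_scaleR_def divide_inverse_commute[symmetric] .
  from sums_if[OF sums_zero this]
  have gauss: "(\<lambda>n. if even n then (x\<^sup>2 / 2) ^ (n div 2) / fact (n div 2) else 0) sums exp (x\<^sup>2 / 2)"
    by simp
  have "cosh x \<le> exp (x\<^sup>2 / 2)"
  proof (rule sums_le[OF _ cosh_converges gauss])
    fix n
    show "(if even n then x ^ n /\<^sub>R fact n else 0)
        \<le> (if even n then (x\<^sup>2 / 2) ^ (n div 2) / fact (n div 2) else 0)"
    proof (cases "even n")
      case True
      then obtain k where n: "n = 2 * k" by (elim evenE)
      have "x ^ (2 * k) / fact (2 * k) \<le> x ^ (2 * k) / (2 ^ k * fact k)"
        using two_power_fact_le[of k] by (intro divide_left_mono) (auto simp: power_mult)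
      moreover have "x ^ (2 * k) /\<^sub>R fact (2 * k) = x ^ (2 * k) / fact (2 * k)"
        by (simp add: divide_inverse)
      moreover have "(x\<^sup>2 / 2) ^ k / fact k = x ^ (2 * k) / (2 ^ k * fact k)"
        by (simp add: power_mult power_divide)
      ultimately have "x ^ (2 * k) /\<^sub>R fact (2 * k) \<le> (x\<^sup>2 / 2) ^ k / fact k"
        by (simp only:)
      then show ?thesis using True by (simp only: n if_True nonzero_mult_div_cancel_left)
    qed simp
  qed
  then show ?thesis unfolding cosh_field_def .
qed

lemma rademacher_sum_second_moment:
  assumes "finite A"
  shows "measure_pmf.expectation (rademacher A) (\<lambda>f. (\<Sum>i\<in>A. f i * w i)\<^sup>2) = (\<Sum>i\<in>A. (w i)\<^sup>2)"
  using assms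
proof (induction A)
  case empty
  then show ?case by simp
next
  case (insert a A)
  note int = integrable_measure_pmf_finite[OF finite_set_rademacher[OF insert(1)]]
  let ?E = "measure_pmf.expectation (rademacher A)"
  have "?E (\<lambda>f. (w a + (\<Sum>i\<in>A. f i * w i))\<^sup>2) + ?E (\<lambda>f. (- w a + (\<Sum>i\<in>A. f i * w i))\<^sup>2)
      = ?E (\<lambda>f. (w a + (\<Sum>i\<in>A. f i * w i))\<^sup>2 + (- w a + (\<Sum>i\<in>A. f i * w i))\<^sup>2)"
    by (rule Bochner_Integration.integral_add[symmetric]) (rule int)+
  also have "\<dots> = ?E (\<lambda>f. 2 * (w a)\<^sup>2 + 2 * (\<Sum>i\<in>A. f i * w i)\<^sup>2)"
    by (intro Bochner_Integration.integral_cong) (auto simp: power2_eq_square algebra_simps)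
  also have "\<dots> = 2 * (w a)\<^sup>2 + 2 * ?E (\<lambda>f. (\<Sum>i\<in>A. f i * w i)\<^sup>2)"
    by (subst Bochner_Integration.integral_add) (auto intro: int)
  finally show ?case
    unfolding expectation_rademacher_insert[OF insert(1,2)] sum_fun_upd_notin[OF insert(1,2)]
    using insert by simp
qed

lemma rademacher_sum_exp_le:
  assumes "finite A"
  shows "measure_pmf.expectation (rademacher A) (\<lambda>f. exp (t * (\<Sum>i\<in>A. f i * w i)))
           \<le> exp (t\<^sup>2 / 2 * (\<Sum>i\<in>A. (w i)\<^sup>2))"
  using assms
proof (induction A)
  case empty
  then show ?case by simp
next
  case (insert a A)
  let ?E = "measure_pmf.expectation (rademacher A)"
  let ?Z = "\<lambda>f. exp (t * (\<Sum>i\<in>A. f i * w i))"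
  have "(?E (\<lambda>f. exp (t * (1 * w a + (\<Sum>i\<in>A. f i * w i)))) +
         ?E (\<lambda>f. exp (t * (- 1 * w a + (\<Sum>i\<in>A. f i * w i))))) / 2
      = (exp (t * w a) + exp (- (t * w a))) / 2 * ?E ?Z"
    by (simp add: distrib_left exp_add right_diff_distrib exp_diff exp_minus field_simps)
  also have "\<dots> \<le> exp ((t * w a)\<^sup>2 / 2) * exp (t\<^sup>2 / 2 * (\<Sum>i\<in>A. (w i)\<^sup>2))"
    using insert(3) cosh_le_exp_half_square[of "t * w a"]
    by (intro mult_mono) auto
  also have "\<dots> = exp (t\<^sup>2 / 2 * (\<Sum>i\<in>insert a A. (w i)\<^sup>2))"
    using insert(1,2) by (simp add: exp_add[symmetric] power_mult_distrib algebra_simps)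
  finally show ?case
    unfolding expectation_rademacher_insert[OF insert(1,2)] sum_fun_upd_notin[OF insert(1,2)] .
qed

text \<open>
  The bound is the exact Gaussian value for the variance, up to the missing square root, and has the
  shape that makes the induction close: averaging over one more sign multiplies the expectation by
  at most \<open>exp (s a\<^sup>2)\<close> and replaces \<open>s\<close> by \<open>s (1 + 2 s a\<^sup>2)\<close>, because
  \<open>cosh (2 s a z) \<le> exp (2 s\<^sup>2 a\<^sup>2 z\<^sup>2)\<close>.
\<close>
lemma rademacher_sum_exp_square_le:
  assumes "finite A" "s \<ge> 0" "2 * s * (\<Sum>i\<in>A. (w i)\<^sup>2) < 1"
  shows "measure_pmf.expectation (rademacher A) (\<lambda>f. exp (s * (\<Sum>i\<in>A. f i * w i)\<^sup>2))
           \<le> 1 / (1 - 2 * s * (\<Sum>i\<in>A. (w i)\<^sup>2))"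
  using assms
proof (induction A arbitrary: s)
  case empty
  then show ?case by simp
next
  case (insert a A)
  note int = integrable_measure_pmf_finite[OF finite_set_rademacher[OF insert(1)]]
  let ?E = "measure_pmf.expectation (rademacher A)"
  define B where "B = (\<Sum>i\<in>A. (w i)\<^sup>2)"
  \<comment> \<open>With these names the induction step is the inequality
  \<open>exp (x / 2) / (1 - y - x y) \<le> 1 / (1 - x - y)\<close>.\<close>
  define x y s' where "x = 2 * s * (w a)\<^sup>2" and "y = 2 * s * B" and "s' = s * (1 + x)"
  have B: "B \<ge> 0" unfolding B_def by (simp add: sum_nonneg)
  have nn: "x \<ge> 0" "y \<ge> 0" "s' \<ge> 0"
    unfolding x_def y_def s'_def using insert(4) B by simp_all
  have xy: "x + y < 1"
    using insert(1,2,5) unfolding x_def y_def B_def by (simp add: algebra_simps)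
  have s'B: "2 * s' * B = y + x * y" by (simp add: s'_def y_def algebra_simps)
  have "y * (1 + x) \<le> (1 - x) * (1 + x)"
    using xy nn by (intro mult_right_mono) auto
  also have "\<dots> = 1 - x * x" by (simp add: algebra_simps)
  finally have yle: "y + x * y \<le> 1 - x * x" by (simp add: algebra_simps)
  have lt: "y + x * y < 1"
  proof (cases "x = 0")
    case True then show ?thesis using xy by simp
  next
    case False
    then have "x * x > 0" using nn by (simp add: less_le)
    then show ?thesis using yle by linarith
  qed
  have pt: "(exp (s * (w a + z)\<^sup>2) + exp (s * (- w a + z)\<^sup>2)) / 2 \<le> exp (x / 2) * exp (s' * z\<^sup>2)"
    for z
  proof -
    have e1: "s * (w a + z)\<^sup>2 = s * z\<^sup>2 + x / 2 + 2 * s * w a * z"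
      and e2: "s * (- w a + z)\<^sup>2 = s * z\<^sup>2 + x / 2 + - (2 * s * w a * z)"
      by (simp_all add: x_def power2_eq_square algebra_simps)
    have "(exp (s * (w a + z)\<^sup>2) + exp (s * (- w a + z)\<^sup>2)) / 2
       = exp (s * z\<^sup>2 + x / 2) * ((exp (2 * s * w a * z) + exp (- (2 * s * w a * z))) / 2)"
      unfolding e1 e2 exp_add by (simp add: algebra_simps)
    also have "\<dots> \<le> exp (s * z\<^sup>2 + x / 2) * exp ((2 * s * w a * z)\<^sup>2 / 2)"
      by (intro mult_left_mono cosh_le_exp_half_square) auto
    also have "\<dots> = exp (x / 2) * exp (s' * z\<^sup>2)"
      unfolding exp_add[symmetric]
      by (rule arg_cong[where f = exp]) (simp add: s'_def x_def power2_eq_square algebra_simps)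
    finally show ?thesis .
  qed
  have "(?E (\<lambda>f. exp (s * (1 * w a + (\<Sum>i\<in>A. f i * w i))\<^sup>2)) +
         ?E (\<lambda>f. exp (s * (- 1 * w a + (\<Sum>i\<in>A. f i * w i))\<^sup>2))) / 2
      = ?E (\<lambda>f. (exp (s * (w a + (\<Sum>i\<in>A. f i * w i))\<^sup>2) +
                 exp (s * (- w a + (\<Sum>i\<in>A. f i * w i))\<^sup>2)) / 2)"
    by (subst integral_divide_zero, subst Bochner_Integration.integral_add) (auto intro: int)
  also have "\<dots> \<le> ?E (\<lambda>f. exp (x / 2) * exp (s' * (\<Sum>i\<in>A. f i * w i)\<^sup>2))"
    by (rule expectation_mono_finite[OF finite_set_rademacher[OF insert(1)] pt])
  also have "\<dots> = exp (x / 2) * ?E (\<lambda>f. exp (s' * (\<Sum>i\<in>A. f i * w i)\<^sup>2))"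
    by simp
  also have "\<dots> \<le> exp (x / 2) * (1 / (1 - 2 * s' * B))"
    using insert(3)[of s'] nn lt unfolding B_def[symmetric] s'B
    by (intro mult_left_mono) auto
  also have "\<dots> \<le> 1 / (1 - x - y)"
  proof -
    have "(1 - x) * (1 - (y + x * y)) \<ge> 1 - x - y"
    proof -
      have "(1 - x) * (1 - (y + x * y)) = 1 - x - y + x * x * y" by (simp add: algebra_simps)
      then show ?thesis using nn by simp
    qed
    moreover have "exp (x / 2) * (1 - x) \<le> 1"
    proof -
      have "exp (x / 2) * (1 - x) \<le> exp (x / 2) * exp (- x / 2)"
        using exp_ge_add_one_self[of "- x / 2"] nn by (intro mult_left_mono) auto
      then show ?thesis by (simp add: exp_minus)
    qed
    ultimately have "exp (x / 2) * (1 - x - y) \<le> 1 * (1 - (y + x * y))"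
    proof -
      assume g: "1 - x - y \<le> (1 - x) * (1 - (y + x * y))" and e: "exp (x / 2) * (1 - x) \<le> 1"
      have "exp (x / 2) * (1 - x - y) \<le> exp (x / 2) * ((1 - x) * (1 - (y + x * y)))"
        using g by (intro mult_left_mono) auto
      also have "\<dots> = exp (x / 2) * (1 - x) * (1 - (y + x * y))" by (simp only: mult.assoc)
      also have "\<dots> \<le> 1 * (1 - (y + x * y))"
        using e lt by (intro mult_right_mono) auto
      finally show ?thesis .
    qed
    then have "exp (x / 2) * (1 - x - y) \<le> 1 - (y + x * y)" by simp
    moreover have "1 - x - y > 0" "1 - (y + x * y) > 0" using lt xy by linarith+
    ultimately show ?thesis
      unfolding s'B by (simp add: divide_le_eq le_divide_eq del: minus_add_distrib)
  qed
  also have "1 - x - y = 1 - 2 * s * (\<Sum>i\<in>insert a A. (w i)\<^sup>2)"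
    using insert(1,2) unfolding x_def y_def B_def by (simp add: algebra_simps)
  finally show ?case
    unfolding expectation_rademacher_insert[OF insert(1,2)] sum_fun_upd_notin[OF insert(1,2)] .
qed

section \<open>Bilinear forms in two Rademacher vectors\<close>

text \<open>
  The law of the bilinear form \<open>\<eta>\<^sup>T M \<xi>\<close> in two independent sign vectors.
\<close>
definition chaos_pmf :: "'i set \<Rightarrow> 'j set \<Rightarrow> ('i \<Rightarrow> 'j \<Rightarrow> real) \<Rightarrow> real pmf" where
  "chaos_pmf A B M = map_pmf (\<lambda>(\<eta>, \<xi>). \<Sum>j\<in>B. \<xi> j * (\<Sum>i\<in>A. \<eta> i * M i j))
     (pair_pmf (rademacher A) (rademacher B))"

lemma finite_set_chaos_pmf: "finite A \<Longrightarrow> finite B \<Longrightarrow> finite (set_pmf (chaos_pmf A B M))"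
  by (auto simp: chaos_pmf_def finite_set_rademacher)

lemma expectation_chaos_pmf:
  fixes F :: "real \<Rightarrow> real"
  assumes "finite A" "finite B"
  shows "measure_pmf.expectation (chaos_pmf A B M) F =
    measure_pmf.expectation (rademacher A) (\<lambda>\<eta>. measure_pmf.expectation (rademacher B)
      (\<lambda>\<xi>. F (\<Sum>j\<in>B. \<xi> j * (\<Sum>i\<in>A. \<eta> i * M i j))))"
  unfolding chaos_pmf_def
  by (simp add: expectation_pair_pmf_finite finite_set_rademacher assms)

lemma chaos_second_moment:
  assumes "finite A" "finite B"
  shows "measure_pmf.expectation (chaos_pmf A B M) (\<lambda>x. x\<^sup>2) = (\<Sum>i\<in>A. \<Sum>j\<in>B. (M i j)\<^sup>2)"
  unfolding expectation_chaos_pmf[OF assms] rademacher_sum_second_moment[OF assms(2)]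
  by (subst Bochner_Integration.integral_sum)
     (auto simp: rademacher_sum_second_moment assms sum.swap[of _ A B]
           intro!: integrable_measure_pmf_finite finite_set_rademacher)

text \<open>
  Given \<open>\<eta>\<close>, the form is a Rademacher sum with weights \<open>Z\<^sub>j = (M\<^sup>T \<eta>)\<^sub>j\<close>, so its exponential
  moment is at most \<open>exp (t\<^sup>2 / 2 \<Sum>\<^sub>j Z\<^sub>j\<^sup>2)\<close>.  The \<open>Z\<^sub>j\<close> are dependent, but Jensen's inequality
  with the weights \<open>p\<^sub>j = \<Sum>\<^sub>i M\<^sub>i\<^sub>j\<^sup>2\<close>, whose sum is 1, bounds this by an average of terms that contain
  a single normalised Rademacher sum \<open>Z\<^sub>j / sqrt p\<^sub>j\<close> each.
\<close>
lemma chaos_exp_moment: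
  assumes "finite A" "finite B" "(\<Sum>i\<in>A. \<Sum>j\<in>B. (M i j)\<^sup>2) = 1" "t\<^sup>2 = 1 / 4"
  shows "measure_pmf.expectation (chaos_pmf A B M) (\<lambda>x. exp (t * x)) \<le> 4 / 3"
proof -
  define p where "p j = (\<Sum>i\<in>A. (M i j)\<^sup>2)" for j
  define Z where "Z \<eta> j = (\<Sum>i\<in>A. \<eta> i * M i j)" for \<eta> j
  let ?E = "measure_pmf.expectation (rademacher A)"
  note fin = finite_set_rademacher[OF assms(1)]
  have p: "(\<Sum>j\<in>B. p j) = 1" "p j \<ge> 0" for j
    unfolding p_def using assms(3) by (auto simp: sum.swap[of _ A B] sum_nonneg)
  \<comment> \<open>A zero column has weight zero; the division by zero in the Jensen step then gives the value 0,
  which is the correct one.\<close>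
  have Z0: "Z \<eta> j = 0" if "p j = 0" for j \<eta>
  proof -
    have "\<forall>i\<in>A. (M i j)\<^sup>2 = 0"
      using that sum_nonneg_eq_0_iff[OF assms(1), of "\<lambda>i. (M i j)\<^sup>2"] unfolding p_def by simp
    then show ?thesis unfolding Z_def by simp
  qed
  have B: "B \<noteq> {}" using p(1) by auto
  have jensen: "exp (t\<^sup>2 / 2 * (\<Sum>j\<in>B. (Z \<eta> j)\<^sup>2)) \<le> (\<Sum>j\<in>B. p j * exp (1 / (8 * p j) * (Z \<eta> j)\<^sup>2))"
    for \<eta>
  proof -
    have "t\<^sup>2 / 2 * (\<Sum>j\<in>B. (Z \<eta> j)\<^sup>2) = (\<Sum>j\<in>B. p j * (1 / (8 * p j) * (Z \<eta> j)\<^sup>2))"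
      unfolding assms(4) sum_distrib_left by (intro sum.cong) (auto simp: Z0)
    moreover have "exp (\<Sum>j\<in>B. p j *\<^sub>R (1 / (8 * p j) * (Z \<eta> j)\<^sup>2))
        \<le> (\<Sum>j\<in>B. p j * exp (1 / (8 * p j) * (Z \<eta> j)\<^sup>2))"
      by (rule convex_on_sum[OF assms(2) B exp_convex]) (auto simp: p)
    ultimately show ?thesis by simp
  qed
  have "measure_pmf.expectation (chaos_pmf A B M) (\<lambda>x. exp (t * x))
      \<le> ?E (\<lambda>\<eta>. exp (t\<^sup>2 / 2 * (\<Sum>j\<in>B. (Z \<eta> j)\<^sup>2)))"
    unfolding expectation_chaos_pmf[OF assms(1,2)] Z_def
    by (intro expectation_mono_finite fin rademacher_sum_exp_le assms)
  also have "\<dots> \<le> ?E (\<lambda>\<eta>. \<Sum>j\<in>B. p j * exp (1 / (8 * p j) * (Z \<eta> j)\<^sup>2))"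
    by (intro expectation_mono_finite fin jensen)
  also have "\<dots> = (\<Sum>j\<in>B. p j * ?E (\<lambda>\<eta>. exp (1 / (8 * p j) * (Z \<eta> j)\<^sup>2)))"
    by (subst Bochner_Integration.integral_sum)
       (auto intro!: integrable_measure_pmf_finite fin)
  also have "\<dots> \<le> (\<Sum>j\<in>B. p j * (4 / 3))"
  proof (intro sum_mono mult_left_mono p)
    fix j assume "j \<in> B"
    show "?E (\<lambda>\<eta>. exp (1 / (8 * p j) * (Z \<eta> j)\<^sup>2)) \<le> 4 / 3"
    proof (cases "p j = 0")
      case False
      then show ?thesis
        using rademacher_sum_exp_square_le[OF assms(1), of "1 / (8 * p j)" "\<lambda>i. M i j"] p(2)[of j]
        unfolding Z_def p_def[symmetric] by simp
    qed simp
  qed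
  also have "\<dots> = 4 / 3" unfolding sum_distrib_right[symmetric] p(1) by simp
  finally show ?thesis .
qed

lemma chaos_exp_abs_moment:
  assumes "finite A" "finite B" "(\<Sum>i\<in>A. \<Sum>j\<in>B. (M i j)\<^sup>2) = 1"
  shows "measure_pmf.expectation (chaos_pmf A B M) (\<lambda>x. exp (\<bar>x\<bar> / 2)) \<le> 3"
proof -
  note fin = finite_set_chaos_pmf[OF assms(1,2), of M]
  note int = integrable_measure_pmf_finite[OF fin]
  let ?E = "measure_pmf.expectation (chaos_pmf A B M)"
  have "?E (\<lambda>x. exp (\<bar>x\<bar> / 2)) \<le> ?E (\<lambda>x. exp (1/2 * x) + exp (- 1/2 * x))"
    by (intro expectation_mono_finite fin) (auto simp: abs_real_def)
  also have "\<dots> = ?E (\<lambda>x. exp (1/2 * x)) + ?E (\<lambda>x. exp (- 1/2 * x))"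
    by (intro Bochner_Integration.integral_add int)
  also have "\<dots> \<le> 4/3 + 4/3"
    by (intro add_mono chaos_exp_moment assms) (auto simp: power2_eq_square)
  finally show ?thesis by simp
qed

section \<open>Concentration of sums of squares of subexponential variables\<close>

text \<open>
  Markov's inequality for the exponential of the sum; the usual parameter is part of \<open>f\<close> and \<open>t\<close>.
\<close>
lemma chernoff_Pi_pmf:
  fixes f :: "'a \<Rightarrow> real" and c t :: real
  assumes "finite I" "finite (set_pmf p)" "measure_pmf.expectation p (\<lambda>x. exp (f x)) \<le> exp c"
  shows "measure_pmf.prob (Pi_pmf I d (\<lambda>_. p)) {r. t \<le> (\<Sum>i\<in>I. f (r i))} \<le> exp (card I * c - t)"
proof -
  let ?P = "Pi_pmf I d (\<lambda>_. p)"
  have fin: "finite (set_pmf ?P)" using assms by (intro finite_set_Pi_pmf)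
  have "measure_pmf.prob ?P {r. t \<le> (\<Sum>i\<in>I. f (r i))}
      = measure_pmf.expectation ?P (indicator {r. t \<le> (\<Sum>i\<in>I. f (r i))})"
    by simp
  also have "\<dots> \<le> measure_pmf.expectation ?P (\<lambda>r. exp (- t) * (\<Prod>i\<in>I. exp (f (r i))))"
    using assms by (intro expectation_mono_finite fin)
      (auto simp: indicator_def exp_sum[symmetric] exp_add[symmetric])
  also have "\<dots> = exp (- t) * measure_pmf.expectation p (\<lambda>x. exp (f x)) ^ card I"
    using expectation_prod_Pi_pmf[OF assms(1), of "\<lambda>_. p" "\<lambda>_ x. exp (f x)" d]
    by (simp add: integrable_measure_pmf_finite[OF assms(2)])
  also have "\<dots> \<le> exp (- t) * exp c ^ card I"
    using assms(3) by (intro mult_left_mono power_mono) (auto intro: integral_nonneg_AE)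
  also have "\<dots> = exp (card I * c - t)"
    by (simp add: exp_of_nat_mult[symmetric] exp_add[symmetric])
  finally show ?thesis .
qed

lemma prob_Pi_pmf_Bex_le:
  assumes "finite I"
  shows "measure_pmf.prob (Pi_pmf I d (\<lambda>_. p)) {r. \<exists>i\<in>I. P (r i)} \<le> card I * measure_pmf.prob p {x. P x}"
proof -
  let ?P = "Pi_pmf I d (\<lambda>_. p)"
  have "measure_pmf.prob ?P (\<Union>i\<in>I. {r. P (r i)}) \<le> (\<Sum>i\<in>I. measure_pmf.prob ?P {r. P (r i)})"
    using assms by (intro measure_pmf.finite_measure_subadditive_finite) auto
  also have "\<dots> = (\<Sum>i\<in>I. measure_pmf.prob p {x. P x})"
  proof (intro sum.cong refl)
    fix i assume i: "i \<in> I"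
    have "measure_pmf.prob (map_pmf (\<lambda>r. r i) ?P) {x. P x} = measure_pmf.prob ?P {r. P (r i)}"
      by (simp add: vimage_def)
    then show "measure_pmf.prob ?P {r. P (r i)} = measure_pmf.prob p {x. P x}"
      using Pi_pmf_component[OF assms, of i d "\<lambda>_. p"] i by simp
  qed
  also have "\<dots> = card I * measure_pmf.prob p {x. P x}" by simp
  also have "(\<Union>i\<in>I. {r. P (r i)}) = {r. \<exists>i\<in>I. P (r i)}" by auto
  finally show ?thesis .
qed

lemma exp_le_quadratic: "exp u \<le> 1 + u + u\<^sup>2 / 2 * exp u" if "u \<ge> 0" for u :: real
proof -
  obtain t where t: "\<bar>t\<bar> \<le> \<bar>u\<bar>" "exp u = (\<Sum>m<2. u ^ m / fact m) + exp t / fact 2 * u ^ 2"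
    using Maclaurin_exp_le[of u 2] by blast
  have "exp t * u\<^sup>2 \<le> exp u * u\<^sup>2" using t(1) that by (intro mult_right_mono) auto
  moreover have "exp u = 1 + u + exp t * u\<^sup>2 / 2" using t(2) by (simp add: lessThan_nat_numeral)
  ultimately show ?thesis by (simp add: mult.commute)
qed

lemma exp_minus_le_quadratic: "exp (- u) \<le> 1 - u + u\<^sup>2 / 2" if "u \<ge> 0" for u :: real
proof -
  have "(1 - u + u\<^sup>2 / 2) * (1 + u + u\<^sup>2 / 2) = 1 + u ^ 4 / 4"
    by (simp add: algebra_simps power2_eq_square power4_eq_xxxx)
  then have "1 \<le> (1 - u + u\<^sup>2 / 2) * (1 + u + u\<^sup>2 / 2)" by simp
  also have "\<dots> \<le> (1 - u + u\<^sup>2 / 2) * exp u"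
  proof (intro mult_left_mono exp_lower_Taylor_quadratic that)
    have "0 \<le> (1 - u)\<^sup>2" by simp
    then show "0 \<le> 1 - u + u\<^sup>2 / 2" by (simp add: power2_eq_square algebra_simps)
  qed
  finally show ?thesis by (simp add: exp_minus field_simps)
qed

text \<open>
  From \<open>u \<le> exp u\<close> at \<open>u = \<bar>x\<bar> / 16\<close>, raised to the fourth power.
\<close>
lemma power4_le_exp: "x ^ 4 \<le> 65536 * exp (\<bar>x\<bar> / 4)" for x :: real
proof -
  have "\<bar>x\<bar> / 16 \<le> exp (\<bar>x\<bar> / 16)"
    using exp_ge_add_one_self[of "\<bar>x\<bar> / 16"] by linarith
  then have "(\<bar>x\<bar> / 16) ^ 4 \<le> exp (\<bar>x\<bar> / 16) ^ 4"
    by (intro power_mono) auto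
  also have "\<dots> = exp (\<bar>x\<bar> / 4)" by (simp add: exp_of_nat_mult[symmetric])
  finally show ?thesis by (simp add: power_divide)
qed

text \<open>
  The variables \<open>X\<close> have unit second moment and are subexponential; the squares are then only
  of Weibull type with exponent one half and have no exponential moment that is bounded uniformly
  in their law.
\<close>
context
  fixes p :: "'a pmf" and X :: "'a \<Rightarrow> real"
  assumes fin: "finite (set_pmf p)"
    and second_moment: "measure_pmf.expectation p (\<lambda>x. (X x)\<^sup>2) = 1"
    and exp_moment: "measure_pmf.expectation p (\<lambda>x. exp (\<bar>X x\<bar> / 2)) \<le> 3"
begin

lemma integrable_finite_support: "integrable (measure_pmf p) (f :: 'a \<Rightarrow> real)"
  by (rule integrable_measure_pmf_finite[OF fin])

lemma tail_from_exp_moment: "measure_pmf.prob p {x. \<bar>X x\<bar> > q} \<le> 3 * exp (- q / 2)"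
proof -
  have "measure_pmf.prob p {x. \<bar>X x\<bar> > q} = measure_pmf.expectation p (indicator {x. \<bar>X x\<bar> > q})"
    by simp
  also have "\<dots> \<le> measure_pmf.expectation p (\<lambda>x. exp (- q / 2) * exp (\<bar>X x\<bar> / 2))"
    by (intro expectation_mono_finite fin) (auto simp: indicator_def exp_add[symmetric])
  also have "\<dots> \<le> exp (- q / 2) * 3" using exp_moment by simp
  finally show ?thesis by simp
qed

text \<open>
  Below the threshold \<open>q\<close> the exponent \<open>l X\<^sup>2\<close> is at most \<open>\<bar>X\<bar> / 4\<close>, so the second order term of the
  exponential is controlled by the exponential moment of \<open>\<bar>X\<bar>\<close>.
\<close>
lemma exp_moment_truncated:
  assumes "l \<ge> 0" "l * q \<le> 1 / 4"
  shows "measure_pmf.expectation p (\<lambda>x. exp (l * (if \<bar>X x\<bar> \<le> q then (X x)\<^sup>2 else 0)))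
           \<le> exp (l + 100000 * l\<^sup>2)"
proof -
  let ?E = "measure_pmf.expectation p"
  have pt: "exp (l * (if \<bar>x\<bar> \<le> q then x\<^sup>2 else 0)) \<le> 1 + l * x\<^sup>2 + l\<^sup>2 * 32768 * exp (\<bar>x\<bar> / 2)" for x
  proof (cases "\<bar>x\<bar> \<le> q")
    case True
    define u where "u = l * x\<^sup>2"
    have "l * \<bar>x\<bar> \<le> 1 / 4" using True assms by (meson mult_left_mono order_trans)
    then have "l * \<bar>x\<bar> * \<bar>x\<bar> \<le> 1 / 4 * \<bar>x\<bar>" by (intro mult_right_mono) auto
    then have "u \<le> \<bar>x\<bar> / 4" by (simp add: u_def power2_eq_square mult.assoc)
    have "u\<^sup>2 * exp u \<le> (l\<^sup>2 * (65536 * exp (\<bar>x\<bar> / 4))) * exp (\<bar>x\<bar> / 4)"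
    proof (intro mult_mono)
      have "u\<^sup>2 = l\<^sup>2 * x ^ 4" by (simp add: u_def power_mult_distrib power4_eq_xxxx power2_eq_square)
      then show "u\<^sup>2 \<le> l\<^sup>2 * (65536 * exp (\<bar>x\<bar> / 4))"
        using power4_le_exp[of x] by (simp add: mult_left_mono)
    qed (use \<open>u \<le> \<bar>x\<bar> / 4\<close> in auto)
    also have "\<dots> = l\<^sup>2 * 65536 * exp (\<bar>x\<bar> / 2)"
      by (simp add: exp_add[symmetric])
    finally have "u\<^sup>2 / 2 * exp u \<le> l\<^sup>2 * 32768 * exp (\<bar>x\<bar> / 2)" by simp
    moreover have "u \<ge> 0" using assms by (simp add: u_def)
    ultimately show ?thesis
      using exp_le_quadratic[of u] True by (simp add: u_def)
  next
    case False then show ?thesis using assms by simp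
  qed
  have "?E (\<lambda>x. exp (l * (if \<bar>X x\<bar> \<le> q then (X x)\<^sup>2 else 0)))
      \<le> ?E (\<lambda>x. 1 + l * (X x)\<^sup>2 + l\<^sup>2 * 32768 * exp (\<bar>X x\<bar> / 2))"
    by (intro expectation_mono_finite fin pt)
  also have "\<dots> = 1 + l * ?E (\<lambda>x. (X x)\<^sup>2) + l\<^sup>2 * 32768 * ?E (\<lambda>x. exp (\<bar>X x\<bar> / 2))"
    by (simp add: integrable_finite_support)
  also have "\<dots> \<le> 1 + l + l\<^sup>2 * 32768 * 3"
    unfolding second_moment using exp_moment by (intro add_mono mult_left_mono) auto
  also have "\<dots> \<le> 1 + (l + 100000 * l\<^sup>2)"
    using zero_le_power2[of l] by linarith
  also have "\<dots> \<le> exp (l + 100000 * l\<^sup>2)" by (rule exp_ge_add_one_self)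
  finally show ?thesis .
qed

text \<open>
  Since \<open>exp (- u) \<le> 1 - u + u\<^sup>2 / 2\<close> on the whole half line, the lower tail needs the fourth moment
  only and no truncation.
\<close>
lemma exp_moment_minus:
  assumes "l \<ge> 0"
  shows "measure_pmf.expectation p (\<lambda>x. exp (- (l * (X x)\<^sup>2))) \<le> exp (- l + 100000 * l\<^sup>2)"
proof -
  let ?E = "measure_pmf.expectation p"
  have pt: "exp (- (l * x\<^sup>2)) \<le> 1 - l * x\<^sup>2 + l\<^sup>2 * 32768 * exp (\<bar>x\<bar> / 2)" for x
  proof -
    have "x ^ 4 \<le> 65536 * exp (\<bar>x\<bar> / 4)" by (rule power4_le_exp)
    also have "\<dots> \<le> 65536 * exp (\<bar>x\<bar> / 2)" by simp
    finally have "l\<^sup>2 * x ^ 4 \<le> l\<^sup>2 * (65536 * exp (\<bar>x\<bar> / 2))" by (intro mult_left_mono) auto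
    moreover have "(l * x\<^sup>2)\<^sup>2 = l\<^sup>2 * x ^ 4"
      by (simp add: power_mult_distrib power4_eq_xxxx power2_eq_square)
    ultimately show ?thesis using exp_minus_le_quadratic[of "l * x\<^sup>2"] assms by simp
  qed
  have "?E (\<lambda>x. exp (- (l * (X x)\<^sup>2))) \<le> ?E (\<lambda>x. 1 - l * (X x)\<^sup>2 + l\<^sup>2 * 32768 * exp (\<bar>X x\<bar> / 2))"
    by (intro expectation_mono_finite fin pt)
  also have "\<dots> = 1 - l * ?E (\<lambda>x. (X x)\<^sup>2) + l\<^sup>2 * 32768 * ?E (\<lambda>x. exp (\<bar>X x\<bar> / 2))"
    by (simp add: integrable_finite_support)
  also have "\<dots> \<le> 1 - l + l\<^sup>2 * 32768 * 3"
    unfolding second_moment using exp_moment by (intro add_mono mult_left_mono) auto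
  also have "\<dots> \<le> 1 + (- l + 100000 * l\<^sup>2)"
    using zero_le_power2[of l] by linarith
  also have "\<dots> \<le> exp (- l + 100000 * l\<^sup>2)" by (rule exp_ge_add_one_self)
  finally show ?thesis .
qed

text \<open>
  The truncation level \<open>q = sqrt (m \<epsilon>)\<close> balances the two sources of error.  The probability that some
  variable exceeds \<open>q\<close> is of order \<open>m exp (- q / 2)\<close>; the factor \<open>m\<close> does no harm because
  \<open>m \<epsilon>\<^sup>2 \<ge> 1\<close> forces \<open>m \<le> q\<^sup>4\<close>.  The truncated sum obeys Chernoff's bound with the exponent
  \<open>min (m \<epsilon>\<^sup>2) (sqrt (m \<epsilon>))\<close> up to constants.  Both are at least of order \<open>k\<close> under the two conditions on
  \<open>m\<close>, which are the origin of the two terms in the sample size of the theorem.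
\<close>
lemma sum_squares_concentration:
  fixes \<epsilon> k :: real and m :: nat
  assumes "\<epsilon> > 0" "k \<ge> 1" "64 * k\<^sup>2 \<le> m * \<epsilon>" "400000 * k \<le> m * \<epsilon>\<^sup>2"
  shows "measure_pmf.prob (Pi_pmf {..<m} d (\<lambda>_. p)) {r. \<bar>(\<Sum>i<m. (X (r i))\<^sup>2) - m\<bar> > m * \<epsilon>}
           \<le> 200000 * exp (- k)"
proof -
  let ?P = "Pi_pmf {..<m} d (\<lambda>_. p)"
  let ?prob = "measure_pmf.prob ?P"
  define q where "q = sqrt (m * \<epsilon>)"
  have q2: "q\<^sup>2 = m * \<epsilon>" unfolding q_def using assms by simp
  have "8 * k \<le> sqrt (m * \<epsilon>)"
    using assms by (intro real_le_rsqrt) (simp add: power_mult_distrib)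
  then have q: "8 * k \<le> q" "q > 0" using assms unfolding q_def[symmetric] by auto
  have mq: "real m \<le> q ^ 4"
  proof -
    have "real m * 1 \<le> m * (m * \<epsilon>\<^sup>2)" using assms by (intro mult_left_mono) auto
    also have "\<dots> = (q\<^sup>2)\<^sup>2" unfolding q2 by (simp add: power2_eq_square)
    finally show ?thesis by simp
  qed
  define l0 where "l0 = \<epsilon> / (2 * 100000)"
  \<comment> \<open>The unconstrained optimum \<open>l0\<close>, capped at the largest parameter for which the truncated
  exponential moment is controlled.\<close>
  define l where "l = min l0 (1 / (4 * q))"
  have l: "0 \<le> l" "l * q \<le> 1 / 4" "100000 * l \<le> \<epsilon> / 2"
    using q assms by (auto simp: l_def l0_def field_simps min_def)
  have large_entry: "?prob {r. \<exists>i\<in>{..<m}. \<bar>X (r i)\<bar> > q} \<le> 196608 * exp (- k)"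
  proof -
    have "?prob {r. \<exists>i\<in>{..<m}. \<bar>X (r i)\<bar> > q} \<le> m * (3 * exp (- q / 2))"
      using prob_Pi_pmf_Bex_le[of "{..<m}" d p "\<lambda>x. \<bar>X x\<bar> > q"] tail_from_exp_moment[of q]
      by (smt (verit) card_lessThan finite_lessThan mult_left_mono of_nat_0_le_iff)
    also have "\<dots> \<le> (65536 * exp (q / 4)) * (3 * exp (- q / 2))"
      using mq power4_le_exp[of q] q by (intro mult_right_mono) auto
    also have "\<dots> = 196608 * exp (- q / 4)"
      by (simp add: exp_add[symmetric])
    also have "\<dots> \<le> 196608 * exp (- k)" using q assms by simp
    finally show ?thesis .
  qed
  have upper: "?prob {r. m * (1 + \<epsilon>) \<le> (\<Sum>i<m. if \<bar>X (r i)\<bar> \<le> q then (X (r i))\<^sup>2 else 0)} \<le> exp (- k)"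
    (is "?prob {r. _ \<le> ?W r} \<le> _")
  proof (cases "l = 0")
    case True
    then have False using q assms by (auto simp: l_def l0_def min_def split: if_splits)
    then show ?thesis ..
  next
    case False
    then have lpos: "l > 0" using l by simp
    have "?prob {r. m * (1 + \<epsilon>) \<le> ?W r}
        = ?prob {r. l * (m * (1 + \<epsilon>)) \<le> (\<Sum>i\<in>{..<m}. l * (if \<bar>X (r i)\<bar> \<le> q then (X (r i))\<^sup>2 else 0))}"
      unfolding sum_distrib_left[symmetric] using lpos by simp
    also have "\<dots> \<le> exp (card {..<m} * (l + 100000 * l\<^sup>2) - l * (m * (1 + \<epsilon>)))"
      by (rule chernoff_Pi_pmf[OF _ fin exp_moment_truncated]) (use l in auto)
    also have "\<dots> \<le> exp (- k)"
    proof -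
      have "card {..<m} * (l + 100000 * l\<^sup>2) - l * (m * (1 + \<epsilon>)) = m * l * (100000 * l - \<epsilon>)"
        by (simp add: algebra_simps power2_eq_square)
      also have "\<dots> \<le> m * l * (- (\<epsilon> / 2))"
        using l by (intro mult_left_mono) auto
      also have "m * l * (- (\<epsilon> / 2)) = - (m * l * (\<epsilon> / 2))" by simp
      also have "\<dots> \<le> - k"
      proof (cases "l = l0")
        case True
        have "m * l * (\<epsilon> / 2) = m * \<epsilon>\<^sup>2 / (4 * 100000)"
          unfolding True l0_def by (simp add: power2_eq_square)
        also have "k \<le> \<dots>" using assms(4) by simp
        finally show ?thesis by simp
      next
        case False
        then have "l = 1 / (4 * q)" by (auto simp: l_def min_def split: if_splits)
        then have "m * l * (\<epsilon> / 2) = q\<^sup>2 / (8 * q)" unfolding q2 by simp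
        also have "\<dots> = q / 8" using q by (simp add: power2_eq_square)
        also have "k \<le> \<dots>" using q by simp
        finally show ?thesis by simp
      qed
      finally show ?thesis by simp
    qed
    finally show ?thesis .
  qed
  have lower: "?prob {r. (\<Sum>i<m. (X (r i))\<^sup>2) \<le> m * (1 - \<epsilon>)} \<le> exp (- k)"
  proof -
    have l0: "l0 > 0" using assms by (simp add: l0_def)
    have "?prob {r. (\<Sum>i<m. (X (r i))\<^sup>2) \<le> m * (1 - \<epsilon>)}
        = ?prob {r. - (l0 * (m * (1 - \<epsilon>))) \<le> (\<Sum>i\<in>{..<m}. - (l0 * (X (r i))\<^sup>2))}"
      unfolding sum_negf sum_distrib_left[symmetric] using l0 by simp
    also have "\<dots> \<le> exp (card {..<m} * (- l0 + 100000 * l0\<^sup>2) - - (l0 * (m * (1 - \<epsilon>))))"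
      by (rule chernoff_Pi_pmf[OF _ fin exp_moment_minus]) (use l0 in auto)
    also have "\<dots> \<le> exp (- k)"
    proof -
      have "card {..<m} * (- l0 + 100000 * l0\<^sup>2) - - (l0 * (m * (1 - \<epsilon>))) = - (m * \<epsilon>\<^sup>2 / (4 * 100000))"
        by (simp add: l0_def field_simps power2_eq_square)
      then show ?thesis using assms(4) by simp
    qed
    finally show ?thesis .
  qed
  have sub: "{r. \<bar>(\<Sum>i<m. (X (r i))\<^sup>2) - m\<bar> > m * \<epsilon>} \<subseteq> {r. \<exists>i\<in>{..<m}. \<bar>X (r i)\<bar> > q} \<union>
      ({r. m * (1 + \<epsilon>) \<le> ?W r} \<union> {r. (\<Sum>i<m. (X (r i))\<^sup>2) \<le> m * (1 - \<epsilon>)})" (is "_ \<subseteq> ?A \<union> (?B \<union> ?C)")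
  proof
    fix r assume r: "r \<in> {r. \<bar>(\<Sum>i<m. (X (r i))\<^sup>2) - m\<bar> > m * \<epsilon>}"
    show "r \<in> ?A \<union> (?B \<union> ?C)"
    proof (cases "r \<in> ?A")
      case False
      then have "?W r = (\<Sum>i<m. (X (r i))\<^sup>2)" by (intro sum.cong) (auto simp: not_less)
      then show ?thesis using r by (auto simp: algebra_simps abs_real_def split: if_splits)
    qed simp
  qed
  have "?prob {r. \<bar>(\<Sum>i<m. (X (r i))\<^sup>2) - m\<bar> > m * \<epsilon>} \<le> ?prob (?A \<union> (?B \<union> ?C))"
    by (rule measure_pmf.finite_measure_mono[OF sub]) simp
  also have "\<dots> \<le> ?prob ?A + (?prob ?B + ?prob ?C)"
    by (intro order_trans[OF measure_Un_le] add_left_mono measure_Un_le) auto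
  also have "\<dots> \<le> 196608 * exp (- k) + (exp (- k) + exp (- k))"
    by (intro add_mono large_entry upper lower)
  finally show ?thesis using exp_gt_zero[of "- k"] by linarith
qed

end

section \<open>Quadratic forms and lattice nets\<close>

text \<open>
  The integer points whose images under division by \<open>6 sqrt d\<close> form a net of the unit ball of
  \<open>\<real>\<^sup>d\<close>.  The bound on the \<open>l\<^sub>1\<close> norm keeps their number exponential in \<open>d\<close>; the box, which
  it implies, lets their count be bounded by a product.
\<close>
definition grid :: "nat \<Rightarrow> (nat \<Rightarrow> int) set" where
  "grid d = {z \<in> {..<d} \<rightarrow>\<^sub>E {- (6 * int d)..6 * int d}. (\<Sum>k<d. \<bar>z k\<bar>) \<le> 6 * int d}"

lemma finite_grid: "finite (grid d)"
proof (rule finite_subset)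
  show "grid d \<subseteq> {..<d} \<rightarrow>\<^sub>E {- (6 * int d)..6 * int d}" by (auto simp: grid_def)
  show "finite ({..<d} \<rightarrow>\<^sub>E {- (6 * int d)..6 * int d})" by (rule finite_PiE) auto
qed

lemma sum_half_power_abs_le: "(\<Sum>j\<in>{- int N..int N}. (1 / 2 :: real) ^ nat \<bar>j\<bar>) \<le> 3"
proof -
  have "(\<Sum>j\<in>{- int N..int N}. (1 / 2 :: real) ^ nat \<bar>j\<bar>) = 3 - 2 * (1 / 2) ^ N"
  proof (induction N)
    case (Suc N)
    have "{- int (Suc N)..int (Suc N)} = insert (- int (Suc N)) (insert (int (Suc N)) {- int N..int N})"
      by auto
    then show ?case using Suc by (simp add: nat_add_distrib)
  qed simp
  then show ?thesis by simp
qed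

text \<open>
  Every point of the grid satisfies \<open>1 \<le> 2\<^bsup>6 d\<^esup> \<Prod>\<^sub>k 2\<^bsup>- \<bar>z\<^sub>k\<bar>\<^esup>\<close>.  The sum of the right-hand side over the
  box factorises, and each factor is at most \<open>\<Sum>\<^sub>j 2\<^bsup>- \<bar>j\<bar>\<^esup> = 3\<close>.
\<close>
lemma card_grid_le: "card (grid d) \<le> (192::real) ^ d"
proof -
  let ?Z = "{- (6 * int d)..6 * int d}"
  have "real (card (grid d)) = (\<Sum>z\<in>grid d. 1)" by simp
  also have "\<dots> \<le> (\<Sum>z\<in>grid d. 2 ^ (6 * d) * (\<Prod>k<d. (1 / 2) ^ nat \<bar>z k\<bar>))"
  proof (intro sum_mono)
    fix z assume z: "z \<in> grid d"
    have "(\<Sum>k<d. nat \<bar>z k\<bar>) \<le> 6 * d"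
    proof -
      have "int (\<Sum>k<d. nat \<bar>z k\<bar>) \<le> int (6 * d)" using z by (simp add: grid_def)
      then show ?thesis by (simp only: of_nat_le_iff)
    qed
    then have "(1 / 2 :: real) ^ (6 * d) \<le> (1 / 2) ^ (\<Sum>k<d. nat \<bar>z k\<bar>)"
      by (intro power_decreasing) auto
    then have "2 ^ (6 * d) * (1 / 2 :: real) ^ (6 * d) \<le> 2 ^ (6 * d) * (1 / 2) ^ (\<Sum>k<d. nat \<bar>z k\<bar>)"
      by (intro mult_left_mono) auto
    then show "(1::real) \<le> 2 ^ (6 * d) * (\<Prod>k<d. (1 / 2) ^ nat \<bar>z k\<bar>)"
      by (simp add: power_sum[symmetric] power_mult_distrib[symmetric])
  qed
  also have "\<dots> \<le> (\<Sum>z\<in>{..<d} \<rightarrow>\<^sub>E ?Z. 2 ^ (6 * d) * (\<Prod>k<d. (1 / 2) ^ nat \<bar>z k\<bar>))"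
  proof (rule sum_mono2)
    show "finite ({..<d} \<rightarrow>\<^sub>E ?Z)" by (rule finite_PiE) auto
    show "grid d \<subseteq> {..<d} \<rightarrow>\<^sub>E ?Z" by (auto simp: grid_def)
    show "0 \<le> (2::real) ^ (6 * d) * (\<Prod>k<d. (1 / 2) ^ nat \<bar>z k\<bar>)" for z :: "nat \<Rightarrow> int"
      by (intro mult_nonneg_nonneg prod_nonneg) auto
  qed
  also have "\<dots> = 2 ^ (6 * d) * (\<Prod>k<d. \<Sum>j\<in>?Z. (1 / 2) ^ nat \<bar>j\<bar>)"
    unfolding sum_distrib_left[symmetric]
    by (rule arg_cong[OF prod_sum_PiE[symmetric]]) auto
  also have "\<dots> \<le> 2 ^ (6 * d) * (\<Prod>k<d. 3)"
  proof (intro mult_left_mono prod_mono conjI)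
    show "(\<Sum>j\<in>?Z. (1 / 2 :: real) ^ nat \<bar>j\<bar>) \<le> 3"
      using sum_half_power_abs_le[of "6 * d"] by (simp only: of_nat_mult of_nat_numeral)
    show "0 \<le> (\<Sum>j\<in>?Z. (1 / 2 :: real) ^ nat \<bar>j\<bar>)" by (intro sum_nonneg) simp
  qed simp
  also have "\<dots> = 192 ^ d" by (simp add: power_mult power_mult_distrib[symmetric])
  finally show ?thesis .
qed

lemma truncate_to_int: "\<exists>j::int. \<bar>of_int j\<bar> \<le> \<bar>t\<bar> \<and> \<bar>t - of_int j\<bar> \<le> 1" for t :: real
proof (cases "t \<ge> 0")
  case True
  then have "\<lfloor>t\<rfloor> \<ge> 0" by simp
  then show ?thesis by (intro exI[of _ "\<lfloor>t\<rfloor>"] conjI) linarith+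
next
  case False
  then have "\<lceil>t\<rceil> \<le> 0" by simp
  then show ?thesis using False by (intro exI[of _ "\<lceil>t\<rceil>"] conjI) linarith+
qed

text \<open>
  Coordinates are truncated towards zero, so that the approximating point stays in the unit ball.
  Each coordinate moves by at most \<open>1 / (6 sqrt d)\<close>, the whole vector by at most \<open>1 / 6\<close>; and
  \<open>\<Sum>\<^sub>k \<bar>y\<^sub>k\<bar> \<le> sqrt d\<close> puts the truncated point into the grid.
\<close>
lemma grid_approximates:
  fixes y :: "nat \<Rightarrow> real"
  assumes "(\<Sum>k<d. (y k)\<^sup>2) \<le> 1" "d > 0"
  shows "\<exists>z\<in>grid d. (\<Sum>k<d. (z k / (6 * sqrt d))\<^sup>2) \<le> 1 \<and>
           (\<Sum>k<d. (6 * (y k - z k / (6 * sqrt d)))\<^sup>2) \<le> 1"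
proof -
  define c where "c = 6 * sqrt (real d)"
  have c: "c > 0" "c\<^sup>2 = 36 * d" using assms(2) by (auto simp: c_def power_mult_distrib)
  have "\<forall>k. \<exists>j::int. \<bar>of_int j\<bar> \<le> \<bar>c * y k\<bar> \<and> \<bar>c * y k - of_int j\<bar> \<le> 1"
    using truncate_to_int by blast
  from choice[OF this] obtain f :: "nat \<Rightarrow> int"
    where f: "\<bar>real_of_int (f k)\<bar> \<le> \<bar>c * y k\<bar>" "\<bar>c * y k - f k\<bar> \<le> 1" for k
    by blast
  have le: "\<bar>f k / c\<bar> \<le> \<bar>y k\<bar>" for k
    using f(1)[of k] c by (simp add: abs_mult field_simps)
  have close: "\<bar>6 * (y k - f k / c)\<bar> \<le> 1 / sqrt d" for k
  proof -
    have "6 * (y k - f k / c) = (c * y k - f k) / sqrt d"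
      using c assms(2) by (simp add: c_def field_simps)
    then show ?thesis using f(2)[of k] assms(2) by (simp add: divide_right_mono)
  qed
  have "(\<Sum>k<d. \<bar>y k\<bar> * 1)\<^sup>2 \<le> (\<Sum>k<d. \<bar>y k\<bar>\<^sup>2) * (\<Sum>k<d. 1\<^sup>2)"
    by (rule Cauchy_Schwarz_ineq_sum)
  also have "\<dots> \<le> 1 * d" using mult_right_mono[OF assms(1), of "real d"] by simp
  finally have "(\<Sum>k<d. \<bar>y k\<bar>) \<le> sqrt d" by (intro real_le_rsqrt) simp
  then have "c * (\<Sum>k<d. \<bar>y k\<bar>) \<le> c * sqrt d"
    using c by (intro mult_left_mono) auto
  also have "\<dots> = 6 * d" by (simp add: c_def)
  finally have "c * (\<Sum>k<d. \<bar>y k\<bar>) \<le> 6 * d" .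
  moreover have "(\<Sum>k<d. \<bar>real_of_int (f k)\<bar>) \<le> (\<Sum>k<d. c * \<bar>y k\<bar>)"
    using f(1) c by (intro sum_mono) (simp add: abs_mult)
  ultimately have "real_of_int (\<Sum>k<d. \<bar>f k\<bar>) \<le> real_of_int (6 * int d)"
    by (simp add: sum_distrib_left)
  then have sum: "(\<Sum>k<d. \<bar>f k\<bar>) \<le> 6 * int d" by (simp only: of_int_le_iff)
  have box: "f k \<in> {- (6 * int d)..6 * int d}" if "k < d" for k
  proof -
    have "\<bar>f k\<bar> \<le> (\<Sum>k<d. \<bar>f k\<bar>)" using that by (intro member_le_sum) auto
    then show ?thesis using sum by auto
  qed
  have "restrict f {..<d} \<in> grid d" using box sum by (auto simp: grid_def)
  moreover have "(\<Sum>k<d. (f k / c)\<^sup>2) \<le> (\<Sum>k<d. (y k)\<^sup>2)"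
    by (intro sum_mono abs_le_square_iff[THEN iffD1, OF le])
  moreover have "(\<Sum>k<d. (6 * (y k - f k / c))\<^sup>2) \<le> (\<Sum>k<d. (1 / sqrt d)\<^sup>2)"
    by (intro sum_mono abs_le_square_iff[THEN iffD1]) (use close in simp)
  moreover have "(\<Sum>k<d. (1 / sqrt d)\<^sup>2) = 1" using assms(2) by (simp add: power_divide)
  ultimately show ?thesis
    using assms(1) unfolding c_def by (intro bexI[of _ "restrict f {..<d}"]) auto
qed

text \<open>
  If \<open>\<bar>q\<bar> \<le> M\<close> on the unit sphere then the polar form \<open>B\<close> is at most \<open>M\<close> there by polarisation.
  Writing \<open>y = x + e / 6\<close> with \<open>x\<close> from the net gives \<open>\<bar>q y\<bar> \<le> \<epsilon> + M / 3 + M / 36 \<le> \<epsilon> + M / 2\<close>.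
  Iterating this improvement from any initial bound \<open>K\<close> leads to \<open>2 \<epsilon>\<close> in the limit, which avoids
  the supremum of \<open>q\<close> over the sphere.
\<close>
lemma quadratic_form_le_of_grid:
  fixes q :: "(nat \<Rightarrow> real) \<Rightarrow> real" and B :: "(nat \<Rightarrow> real) \<Rightarrow> (nat \<Rightarrow> real) \<Rightarrow> real"
  assumes expand: "\<And>x e t. q (\<lambda>k. x k + t * e k) = q x + 2 * t * B x e + t\<^sup>2 * q e"
    and scale: "\<And>x t. q (\<lambda>k. t * x k) = t\<^sup>2 * q x"
    and bound: "\<And>x. \<bar>q x\<bar> \<le> K * (\<Sum>k<d. (x k)\<^sup>2)" and "K \<ge> 0" and "\<epsilon> \<ge> 0"
    and on_grid: "\<And>z. z \<in> grid d \<Longrightarrow> \<bar>q (\<lambda>k. z k / (6 * sqrt d))\<bar> \<le> \<epsilon> * (\<Sum>k<d. (z k / (6 * sqrt d))\<^sup>2)"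
  shows "\<bar>q y\<bar> \<le> 2 * \<epsilon> * (\<Sum>k<d. (y k)\<^sup>2)"
proof -
  have improve: "\<bar>q v\<bar> \<le> (\<epsilon> + M / 2) * (\<Sum>k<d. (v k)\<^sup>2)"
    if M: "\<And>v. \<bar>q v\<bar> \<le> M * (\<Sum>k<d. (v k)\<^sup>2)" and "M \<ge> 0" for M v
  proof (cases "(\<Sum>k<d. (v k)\<^sup>2) = 0")
    case True
    then show ?thesis using bound[of v] by simp
  next
    case False
    define N where "N = (\<Sum>k<d. (v k)\<^sup>2)"
    have "N \<ge> 0" unfolding N_def by (simp add: sum_nonneg)
    then have N: "N > 0" using False unfolding N_def by linarith
    have "d > 0" using False by (cases d) auto
    define y where "y k = v k / sqrt N" for k
    have "(\<Sum>k<d. (y k)\<^sup>2) = 1"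
      using N unfolding y_def power_divide sum_divide_distrib[symmetric] by (simp add: N_def)
    then obtain z where z: "z \<in> grid d" "(\<Sum>k<d. (z k / (6 * sqrt d))\<^sup>2) \<le> 1"
        "(\<Sum>k<d. (6 * (y k - z k / (6 * sqrt d)))\<^sup>2) \<le> 1"
      using grid_approximates[of y d] \<open>d > 0\<close> by auto
    define x e where "x k = z k / (6 * sqrt d)" and "e k = 6 * (y k - x k)" for k
    have x: "(\<Sum>k<d. (x k)\<^sup>2) \<le> 1" and e: "(\<Sum>k<d. (e k)\<^sup>2) \<le> 1"
      using z by (simp_all add: x_def e_def)
    have "q (\<lambda>k. x k + 1 * e k) - q (\<lambda>k. x k + (- 1) * e k) = 4 * B x e"
      unfolding expand by simp
    moreover have "\<bar>q (\<lambda>k. x k + 1 * e k)\<bar> + \<bar>q (\<lambda>k. x k + (- 1) * e k)\<bar>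
        \<le> M * (\<Sum>k<d. (x k + 1 * e k)\<^sup>2) + M * (\<Sum>k<d. (x k + (- 1) * e k)\<^sup>2)"
      by (intro add_mono M)
    moreover have "\<dots> = M * (2 * (\<Sum>k<d. (x k)\<^sup>2) + 2 * (\<Sum>k<d. (e k)\<^sup>2))"
      unfolding distrib_left[symmetric] sum.distrib[symmetric] sum_distrib_left
      by (intro arg_cong2[where f = "(*)"] sum.cong refl) (simp add: power2_eq_square algebra_simps)
    moreover have "\<dots> \<le> M * 4" using x e \<open>M \<ge> 0\<close> by (intro mult_left_mono) auto
    ultimately have B: "\<bar>B x e\<bar> \<le> M" by linarith
    have "y = (\<lambda>k. x k + (1 / 6) * e k)" by (simp add: e_def fun_eq_iff field_simps)
    then have "q y = q x + 1 / 3 * B x e + 1 / 36 * q e"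
      by (simp only: expand) (simp add: power2_eq_square)
    moreover have "\<bar>q x\<bar> \<le> \<epsilon>"
      using on_grid[OF z(1)] mult_left_mono[OF x \<open>\<epsilon> \<ge> 0\<close>] unfolding x_def by simp
    moreover have "\<bar>q e\<bar> \<le> M"
      using M[of e] mult_left_mono[OF e \<open>M \<ge> 0\<close>] by simp
    ultimately have "\<bar>q y\<bar> \<le> \<epsilon> + M / 2" using B \<open>M \<ge> 0\<close> by (simp add: abs_le_iff)
    moreover have "q v = N * q y"
    proof -
      have "v = (\<lambda>k. sqrt N * y k)" using N by (simp add: y_def)
      then show ?thesis using scale[of "sqrt N" y] N by simp
    qed
    ultimately show ?thesis
      unfolding N_def[symmetric] using N by (simp add: abs_mult mult.commute)
  qed
  have iterate: "\<bar>q v\<bar> \<le> (2 * \<epsilon> + K * (1 / 2) ^ n) * (\<Sum>k<d. (v k)\<^sup>2)" for n v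
  proof (induction n arbitrary: v)
    case 0
    have "K * (\<Sum>k<d. (v k)\<^sup>2) \<le> (2 * \<epsilon> + K) * (\<Sum>k<d. (v k)\<^sup>2)"
      using \<open>\<epsilon> \<ge> 0\<close> by (intro mult_right_mono) (auto intro: sum_nonneg)
    then show ?case using bound[of v] by simp
  next
    case (Suc n)
    have "\<epsilon> + (2 * \<epsilon> + K * (1 / 2) ^ n) / 2 = 2 * \<epsilon> + K * (1 / 2) ^ Suc n"
      by (simp add: add_divide_distrib)
    moreover have "0 \<le> 2 * \<epsilon> + K * (1 / 2) ^ n" using \<open>K \<ge> 0\<close> \<open>\<epsilon> \<ge> 0\<close> by simp
    ultimately show ?case
      using improve[OF Suc, of v] by (simp only:)
  qed
  have "(\<lambda>n. (2 * \<epsilon> + K * (1 / 2) ^ n) * (\<Sum>k<d. (y k)\<^sup>2)) \<longlonglongrightarrow> (2 * \<epsilon> + K * 0) * (\<Sum>k<d. (y k)\<^sup>2)"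
    by (intro tendsto_intros LIMSEQ_power_zero) auto
  then show ?thesis
    using iterate[of y] by (intro LIMSEQ_le_const[where X = "\<lambda>n. (2 * \<epsilon> + K * (1 / 2) ^ n) * (\<Sum>k<d. (y k)\<^sup>2)"]) auto
qed

section \<open>Orthonormal coordinates\<close>

definition orthonormal :: "nat \<Rightarrow> nat \<Rightarrow> (nat \<Rightarrow> nat \<Rightarrow> real) \<Rightarrow> bool" where
  "orthonormal n d u \<longleftrightarrow> (\<forall>j<d. \<forall>k<d. (\<Sum>i<n. u j i * u k i) = (if j = k then 1 else 0))"

definition lin_comb :: "nat \<Rightarrow> (nat \<Rightarrow> nat \<Rightarrow> real) \<Rightarrow> (nat \<Rightarrow> real) \<Rightarrow> nat \<Rightarrow> real" where
  "lin_comb d u y i = (\<Sum>k<d. y k * u k i)"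

lemma inner_lin_comb: "(\<Sum>i<n. a i * lin_comb d u y i) = (\<Sum>k<d. (\<Sum>i<n. a i * u k i) * y k)"
  unfolding lin_comb_def sum_distrib_left sum_distrib_right
  by (subst sum.swap) (simp add: mult_ac)

lemma orthonormal_coefficient:
  assumes "orthonormal n d u" "j < d"
  shows "(\<Sum>i<n. u j i * lin_comb d u y i) = y j"
proof -
  have "(\<Sum>i<n. u j i * lin_comb d u y i) = (\<Sum>k<d. if k = j then y k else 0)"
    unfolding inner_lin_comb using assms by (intro sum.cong) (auto simp: orthonormal_def)
  then show ?thesis using assms(2) by simp
qed

lemma orthonormal_norm:
  assumes "orthonormal n d u"
  shows "(\<Sum>i<n. (lin_comb d u y i)\<^sup>2) = (\<Sum>k<d. (y k)\<^sup>2)"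
proof -
  have "(\<Sum>i<n. (lin_comb d u y i)\<^sup>2) = (\<Sum>i<n. lin_comb d u y i * lin_comb d u y i)"
    by (simp add: power2_eq_square)
  also have "\<dots> = (\<Sum>k<d. (\<Sum>i<n. u k i * lin_comb d u y i) * y k)"
    by (rule trans[OF inner_lin_comb]) (simp add: mult.commute)
  also have "\<dots> = (\<Sum>k<d. (y k)\<^sup>2)"
    by (intro sum.cong) (simp_all add: orthonormal_coefficient[OF assms] power2_eq_square)
  finally show ?thesis .
qed

text \<open>
  Gram-Schmidt for possibly dependent families: a vector whose residual vanishes adds nothing to the
  basis, hence \<open>d\<close> may be smaller than \<open>s\<close>.
\<close>
lemma gram_schmidt_exists:
  fixes v :: "nat \<Rightarrow> nat \<Rightarrow> real"
  shows "\<exists>d\<le>s. \<exists>u. orthonormal n d u \<and> (\<forall>j<s. \<exists>y. \<forall>i<n. v j i = lin_comb d u y i)"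
proof (induction s)
  case 0
  show ?case by (auto simp: orthonormal_def)
next
  case (Suc s)
  then obtain d u where d: "d \<le> s" and u: "orthonormal n d u"
    and span: "\<forall>j<s. \<exists>y. \<forall>i<n. v j i = lin_comb d u y i" by blast
  define c where "c k = (\<Sum>i<n. u k i * v s i)" for k
  define w where "w i = v s i - lin_comb d u c i" for i
  define N where "N = (\<Sum>i<n. (w i)\<^sup>2)"
  show ?case
  proof (cases "N = 0")
    case True
    then have "w i = 0" if "i < n" for i
      using that sum_nonneg_eq_0_iff[of "{..<n}" "\<lambda>i. (w i)\<^sup>2"] unfolding N_def by simp
    then have "\<forall>i<n. v s i = lin_comb d u c i" by (simp add: w_def)
    then show ?thesis using d u span by (metis le_Suc_eq less_antisym)
  next
    case False
    have "N \<ge> 0" unfolding N_def by (simp add: sum_nonneg)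
    then have N: "N > 0" using False by simp
    have orth: "(\<Sum>i<n. u j i * w i) = 0" if "j < d" for j
      unfolding w_def right_diff_distrib sum_subtractf orthonormal_coefficient[OF u that]
      by (simp add: c_def)
    define u' where "u' = u(d := \<lambda>i. w i / sqrt N)"
    have u': "u' d = (\<lambda>i. w i / sqrt N)" "\<And>k. k < d \<Longrightarrow> u' k = u k" by (auto simp: u'_def)
    have comb: "lin_comb (Suc d) u' y i = lin_comb d u y i + y d * (w i / sqrt N)" for y i
      unfolding lin_comb_def by (simp add: u')
    have orth': "(\<Sum>i<n. u j i * (w i / sqrt N)) = 0" if "j < d" for j
      using orth[OF that] by (simp add: sum_divide_distrib[symmetric])
    have "(\<Sum>i<n. (w i / sqrt N) * (w i / sqrt N)) = (\<Sum>i<n. (w i)\<^sup>2) / N"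
      unfolding sum_divide_distrib using N by (simp add: power2_eq_square)
    then have one: "(\<Sum>i<n. (w i / sqrt N) * (w i / sqrt N)) = 1" using N unfolding N_def by simp
    have "orthonormal n (Suc d) u'"
      unfolding orthonormal_def
    proof (intro allI impI)
      fix j k assume "j < Suc d" "k < Suc d"
      then consider "j < d" "k < d" | "j < d" "k = d" | "j = d" "k < d" | "j = d" "k = d" by linarith
      then show "(\<Sum>i<n. u' j i * u' k i) = (if j = k then 1 else 0)"
      proof cases
        case 1 then show ?thesis using u by (simp add: u' orthonormal_def)
      next
        case 2 then show ?thesis using orth' by (simp add: u')
      next
        case 3 then show ?thesis using orth' by (simp add: u' mult.commute)
      next
        case 4 then show ?thesis using one by (simp add: u')
      qed
    qed
    moreover have "\<exists>y. \<forall>i<n. v j i = lin_comb (Suc d) u' y i" if "j < Suc s" for j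
    proof (cases "j = s")
      case True
      have "lin_comb d u (c(d := sqrt N)) i = lin_comb d u c i" for i
        unfolding lin_comb_def by (intro sum.cong) auto
      then have "\<forall>i<n. v s i = lin_comb (Suc d) u' (c(d := sqrt N)) i"
        unfolding comb using N by (simp add: w_def)
      then show ?thesis using True by blast
    next
      case False
      then have "j < s" using that by simp
      then obtain y where y: "\<forall>i<n. v j i = lin_comb d u y i" using span by blast
      have "lin_comb d u (y(d := 0)) i = lin_comb d u y i" for i
        unfolding lin_comb_def by (intro sum.cong) auto
      then have "\<forall>i<n. v j i = lin_comb (Suc d) u' (y(d := 0)) i"
        unfolding comb using y by simp
      then show ?thesis by blast
    qed
    ultimately show ?thesis using d by (meson Suc_le_mono)
  qed
qed

text \<open>
  In the coordinates \<open>y\<close> the deviation of the squared norm is a quadratic form, so its values on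
  the net determine it up to a factor 2.
\<close>
lemma subspace_embedding_of_grid:
  fixes a u :: "nat \<Rightarrow> nat \<Rightarrow> real" and \<epsilon> :: real
  assumes u: "orthonormal n d u" and "\<epsilon> \<ge> 0"
    and on_grid: "\<And>z v. z \<in> grid d \<Longrightarrow> v = lin_comb d u (\<lambda>k. z k / (6 * sqrt d)) \<Longrightarrow>
      \<bar>(\<Sum>l<m. (\<Sum>i<n. a l i * v i)\<^sup>2) - m * (\<Sum>i<n. (v i)\<^sup>2)\<bar> \<le> m * \<epsilon> * (\<Sum>i<n. (v i)\<^sup>2)"
  shows "\<bar>(\<Sum>l<m. (\<Sum>i<n. a l i * lin_comb d u y i)\<^sup>2) - m * (\<Sum>i<n. (lin_comb d u y i)\<^sup>2)\<bar>
           \<le> m * (2 * \<epsilon>) * (\<Sum>i<n. (lin_comb d u y i)\<^sup>2)"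
proof -
  define g where "g l k = (\<Sum>i<n. a l i * u k i)" for l k
  define b where "b x l = (\<Sum>k<d. g l k * x k)" for x :: "nat \<Rightarrow> real" and l
  define q where "q x = (\<Sum>l<m. (b x l)\<^sup>2) - m * (\<Sum>k<d. (x k)\<^sup>2)" for x :: "nat \<Rightarrow> real"
  define B where "B x e = (\<Sum>l<m. b x l * b e l) - m * (\<Sum>k<d. x k * e k)" for x e :: "nat \<Rightarrow> real"
  have q: "(\<Sum>l<m. (\<Sum>i<n. a l i * lin_comb d u y i)\<^sup>2) - m * (\<Sum>i<n. (lin_comb d u y i)\<^sup>2) = q y" for y
    unfolding q_def b_def g_def inner_lin_comb orthonormal_norm[OF u] ..
  have b_add: "b (\<lambda>k. x k + t * e k) l = b x l + t * b e l" for x t e l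
    unfolding b_def sum_distrib_left sum.distrib[symmetric]
    by (intro sum.cong refl) (simp add: algebra_simps)
  have b_scale: "b (\<lambda>k. t * x k) l = t * b x l" for x t l
    unfolding b_def sum_distrib_left by (intro sum.cong refl) (simp add: algebra_simps)
  have b_le: "(b x l)\<^sup>2 \<le> (\<Sum>k<d. (g l k)\<^sup>2) * (\<Sum>k<d. (x k)\<^sup>2)" for x l
    unfolding b_def by (rule Cauchy_Schwarz_ineq_sum)
  have square: "(\<Sum>l\<in>L. (f l + t * h l)\<^sup>2) = (\<Sum>l\<in>L. (f l)\<^sup>2) + 2 * t * (\<Sum>l\<in>L. f l * h l) + t\<^sup>2 * (\<Sum>l\<in>L. (h l)\<^sup>2)"
    for L :: "nat set" and f h :: "nat \<Rightarrow> real" and t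
    unfolding sum_distrib_left sum.distrib[symmetric]
    by (intro sum.cong refl) (simp add: power2_eq_square algebra_simps)
  have regroup: "(P + 2 * t * Q + t\<^sup>2 * R) - c * (P' + 2 * t * Q' + t\<^sup>2 * R')
      = P - c * P' + 2 * t * (Q - c * Q') + t\<^sup>2 * (R - c * R')" for P Q R P' Q' R' t c :: real
    by (simp add: algebra_simps)
  have "\<bar>q y\<bar> \<le> 2 * (m * \<epsilon>) * (\<Sum>k<d. (y k)\<^sup>2)"
  proof (rule quadratic_form_le_of_grid[where B = B and K = "(\<Sum>l<m. \<Sum>k<d. (g l k)\<^sup>2) + m"])
    show "q (\<lambda>k. x k + t * e k) = q x + 2 * t * B x e + t\<^sup>2 * q e" for x e t
      unfolding q_def B_def b_add square by (rule regroup)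
    show "q (\<lambda>k. t * x k) = t\<^sup>2 * q x" for x t
      unfolding q_def b_scale power_mult_distrib sum_distrib_left[symmetric] right_diff_distrib
      by (simp only: mult.left_commute)
    show "\<bar>q x\<bar> \<le> ((\<Sum>l<m. \<Sum>k<d. (g l k)\<^sup>2) + m) * (\<Sum>k<d. (x k)\<^sup>2)" for x
    proof -
      have "(\<Sum>l<m. (b x l)\<^sup>2) \<le> (\<Sum>l<m. (\<Sum>k<d. (g l k)\<^sup>2) * (\<Sum>k<d. (x k)\<^sup>2))"
        by (intro sum_mono b_le)
      moreover have "0 \<le> (\<Sum>l<m. (b x l)\<^sup>2)" "0 \<le> m * (\<Sum>k<d. (x k)\<^sup>2)"
        by (auto intro!: sum_nonneg mult_nonneg_nonneg)
      ultimately show ?thesis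
        unfolding q_def distrib_right sum_distrib_right by linarith
    qed
    show "0 \<le> (\<Sum>l<m. \<Sum>k<d. (g l k)\<^sup>2) + real m" by (simp add: sum_nonneg)
    show "0 \<le> m * \<epsilon>" using \<open>\<epsilon> \<ge> 0\<close> by simp
    show "\<bar>q (\<lambda>k. z k / (6 * sqrt d))\<bar> \<le> m * \<epsilon> * (\<Sum>k<d. (z k / (6 * sqrt d))\<^sup>2)" if "z \<in> grid d" for z
      using on_grid[OF that refl] unfolding q unfolding orthonormal_norm[OF u] .
  qed
  then show ?thesis unfolding q unfolding orthonormal_norm[OF u]
    by (simp only: mult.left_commute[of "real m" 2 \<epsilon>])
qed

section \<open>Random rows of Kronecker form\<close>

lemma sum_lessThan_mult:
  fixes f :: "nat \<Rightarrow> 'b::comm_monoid_add"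
  shows "(\<Sum>i<m * n. f i) = (\<Sum>a<m. \<Sum>b<n. f (a * n + b))"
proof -
  have "sum f {a * n..<a * n + n} = (\<Sum>b<n. f (a * n + b))" for a
    by (simp add: sum.atLeastLessThan_shift_0[of f "a * n"] lessThan_atLeast0)
  then show ?thesis by (simp add: sum.nat_group[symmetric])
qed

text \<open>
  Cutting \<open>v\<close> into \<open>n1\<close> blocks of length \<open>n2\<close> turns the inner product with \<open>\<eta> \<otimes> \<xi>\<close> into a bilinear
  form, whose matrix has the squared Frobenius norm \<open>\<Sum>\<^sub>i v\<^sub>i\<^sup>2\<close>.
\<close>
lemma kronecker_row_inner:
  assumes "\<eta> \<in> carrier_vec n1" "\<xi> \<in> carrier_vec n2"
  shows "(\<Sum>i<n1 * n2. Matrix.row (mat_of_row \<eta> \<otimes>\<^sub>K mat_of_row \<xi>) 0 $ i * v i)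
       = (\<Sum>b<n2. \<xi> $ b * (\<Sum>a<n1. \<eta> $ a * (v (a * n2 + b) :: real)))"
proof -
  have "(\<Sum>i<n1 * n2. Matrix.row (mat_of_row \<eta> \<otimes>\<^sub>K mat_of_row \<xi>) 0 $ i * v i)
      = (\<Sum>i<n1 * n2. \<eta> $ (i div n2) * \<xi> $ (i mod n2) * v i)"
  proof (intro sum.cong refl)
    fix i assume "i \<in> {..<n1 * n2}"
    then have "i < n1 * n2" "i div n2 < n1" "i mod n2 < n2"
      by (auto simp: less_mult_imp_div_less intro!: mod_less_divisor gr0I)
    then show "Matrix.row (mat_of_row \<eta> \<otimes>\<^sub>K mat_of_row \<xi>) 0 $ i * v i = \<eta> $ (i div n2) * \<xi> $ (i mod n2) * v i"
      using assms by (simp add: kronecker_product_def mat_of_row_def)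
  qed
  also have "\<dots> = (\<Sum>a<n1. \<Sum>b<n2. \<xi> $ b * (\<eta> $ a * v (a * n2 + b)))"
    unfolding sum_lessThan_mult by (intro sum.cong refl) simp
  also have "\<dots> = (\<Sum>b<n2. \<xi> $ b * (\<Sum>a<n1. \<eta> $ a * v (a * n2 + b)))"
    unfolding sum_distrib_left by (rule sum.swap)
  finally show ?thesis .
qed

lemma kronecker_row_inner_chaos:
  "map_pmf (\<lambda>a. \<Sum>i<n1 * n2. a $ i * v i) (kronecker_row_pmf n1 n2)
     = chaos_pmf {..<n1} {..<n2} (\<lambda>a b. v (a * n2 + b))"
  unfolding kronecker_row_pmf_def rademacher_vec_pmf_def chaos_pmf_def map_pair[symmetric] pmf.map_comp
  by (intro map_pmf_cong refl) (auto simp: kronecker_row_inner)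

lemma finite_set_kronecker_row_pmf: "finite (set_pmf (kronecker_row_pmf n1 n2))"
  by (simp add: kronecker_row_pmf_def rademacher_vec_pmf_def finite_set_rademacher)

lemma kronecker_rows_concentration:
  fixes v :: "nat \<Rightarrow> real" and \<epsilon> k :: real and m :: nat
  assumes "\<epsilon> > 0" "k \<ge> 1" "64 * k\<^sup>2 \<le> m * \<epsilon>" "400000 * k \<le> m * \<epsilon>\<^sup>2"
  shows "measure_pmf.prob (Pi_pmf {..<m} d (\<lambda>_. kronecker_row_pmf n1 n2))
           {r. \<bar>(\<Sum>l<m. (\<Sum>i<n1 * n2. r l $ i * v i)\<^sup>2) - m * (\<Sum>i<n1 * n2. (v i)\<^sup>2)\<bar>
                 > m * \<epsilon> * (\<Sum>i<n1 * n2. (v i)\<^sup>2)}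
         \<le> 200000 * exp (- k)"
proof -
  define N where "N = (\<Sum>i<n1 * n2. (v i)\<^sup>2)"
  have N0: "N \<ge> 0" by (simp add: N_def sum_nonneg)
  show ?thesis
  proof (cases "N = 0")
    case True
    then have "v i = 0" if "i < n1 * n2" for i
      using that sum_nonneg_eq_0_iff[of "{..<n1 * n2}" "\<lambda>i. (v i)\<^sup>2"] unfolding N_def by simp
    then have "(\<Sum>i<n1 * n2. r l $ i * v i) = 0" for r :: "nat \<Rightarrow> real vec" and l
      by (intro sum.neutral) auto
    then show ?thesis unfolding N_def[symmetric] True by simp
  next
    case False
    then have N: "N > 0" using N0 by simp
    define w where "w i = v i / sqrt N" for i
    define X where "X a = (\<Sum>i<n1 * n2. a $ i * w i)" for a :: "real vec"
    have X: "(X a)\<^sup>2 = (\<Sum>i<n1 * n2. a $ i * v i)\<^sup>2 / N" for a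
      using N by (simp add: X_def w_def sum_divide_distrib[symmetric] power_divide)
    have "(\<Sum>i<n1 * n2. (w i)\<^sup>2) = 1"
      using N by (simp add: w_def power_divide sum_divide_distrib[symmetric] N_def[symmetric])
    then have unit: "(\<Sum>a<n1. \<Sum>b<n2. (w (a * n2 + b))\<^sup>2) = 1"
      by (simp add: sum_lessThan_mult)
    have law: "measure_pmf.expectation (kronecker_row_pmf n1 n2) (\<lambda>a. F (X a))
        = measure_pmf.expectation (chaos_pmf {..<n1} {..<n2} (\<lambda>a b. w (a * n2 + b))) F"
      for F :: "real \<Rightarrow> real"
      unfolding kronecker_row_inner_chaos[symmetric] X_def by simp
    have "measure_pmf.prob (Pi_pmf {..<m} d (\<lambda>_. kronecker_row_pmf n1 n2))
        {r. \<bar>(\<Sum>l<m. (X (r l))\<^sup>2) - m\<bar> > m * \<epsilon>} \<le> 200000 * exp (- k)"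
    proof (rule sum_squares_concentration[OF finite_set_kronecker_row_pmf])
      show "measure_pmf.expectation (kronecker_row_pmf n1 n2) (\<lambda>a. (X a)\<^sup>2) = 1"
        using law[of "\<lambda>x. x\<^sup>2"] chaos_second_moment[of "{..<n1}" "{..<n2}"] unit by simp
      show "measure_pmf.expectation (kronecker_row_pmf n1 n2) (\<lambda>a. exp (\<bar>X a\<bar> / 2)) \<le> 3"
        using law[of "\<lambda>x. exp (\<bar>x\<bar> / 2)"] chaos_exp_abs_moment[OF _ _ unit] by simp
    qed (use assms in auto)
    also have "(\<lambda>r. m * \<epsilon> < \<bar>(\<Sum>l<m. (X (r l))\<^sup>2) - m\<bar>) =
      (\<lambda>r. m * \<epsilon> * N < \<bar>(\<Sum>l<m. (\<Sum>i<n1 * n2. r l $ i * v i)\<^sup>2) - m * N\<bar>)"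
    proof
      fix r :: "nat \<Rightarrow> real vec"
      define T where "T = (\<Sum>l<m. (\<Sum>i<n1 * n2. r l $ i * v i)\<^sup>2)"
      have XT: "(\<Sum>l<m. (X (r l))\<^sup>2) = T / N"
        unfolding X T_def sum_divide_distrib ..
      have "T - m * N = (T / N - m) * N" using N by (simp add: left_diff_distrib)
      then have "\<bar>T - m * N\<bar> = \<bar>T / N - m\<bar> * N" using N by (simp only: abs_mult abs_of_pos)
      then show "(m * \<epsilon> < \<bar>(\<Sum>l<m. (X (r l))\<^sup>2) - m\<bar>) =
        (m * \<epsilon> * N < \<bar>(\<Sum>l<m. (\<Sum>i<n1 * n2. r l $ i * v i)\<^sup>2) - m * N\<bar>)"
        unfolding XT T_def[symmetric] using N by simp
    qed
    finally show ?thesis unfolding N_def .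
  qed
qed

text \<open>
  Union bound over the net of a subspace with the orthonormal basis \<open>u\<close>.
\<close>
lemma kronecker_subspace_embedding:
  fixes \<epsilon> k :: real and m :: nat
  assumes "\<epsilon> > 0" "k \<ge> 1" "64 * k\<^sup>2 \<le> m * \<epsilon>" "400000 * k \<le> m * \<epsilon>\<^sup>2"
    and u: "orthonormal (n1 * n2) d u"
  shows "measure_pmf.prob (Pi_pmf {..<m} dflt (\<lambda>_. kronecker_row_pmf n1 n2))
           {r. \<forall>y. \<bar>(\<Sum>l<m. (\<Sum>i<n1 * n2. r l $ i * lin_comb d u y i)\<^sup>2)
                     - m * (\<Sum>i<n1 * n2. (lin_comb d u y i)\<^sup>2)\<bar>
                 \<le> m * (2 * \<epsilon>) * (\<Sum>i<n1 * n2. (lin_comb d u y i)\<^sup>2)}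
         \<ge> 1 - 192 ^ d * (200000 * exp (- k))" (is "measure_pmf.prob ?P ?G \<ge> _")
proof -
  define v where "v z = lin_comb d u (\<lambda>k. real_of_int (z k) / (6 * sqrt d))" for z
  define bad where "bad z = {r. \<bar>(\<Sum>l<m. (\<Sum>i<n1 * n2. r l $ i * v z i)\<^sup>2) - m * (\<Sum>i<n1 * n2. (v z i)\<^sup>2)\<bar>
                 > m * \<epsilon> * (\<Sum>i<n1 * n2. (v z i)\<^sup>2)}" for z
  have "- ?G \<subseteq> (\<Union>z\<in>grid d. bad z)"
  proof
    fix r assume "r \<in> - ?G"
    then obtain y where y: "\<not> \<bar>(\<Sum>l<m. (\<Sum>i<n1 * n2. r l $ i * lin_comb d u y i)\<^sup>2)
                     - m * (\<Sum>i<n1 * n2. (lin_comb d u y i)\<^sup>2)\<bar>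
                 \<le> m * (2 * \<epsilon>) * (\<Sum>i<n1 * n2. (lin_comb d u y i)\<^sup>2)" by blast
    show "r \<in> (\<Union>z\<in>grid d. bad z)"
    proof (rule ccontr)
      assume not_bad: "r \<notin> (\<Union>z\<in>grid d. bad z)"
      have "\<bar>(\<Sum>l<m. (\<Sum>i<n1 * n2. r l $ i * lin_comb d u y i)\<^sup>2)
                     - m * (\<Sum>i<n1 * n2. (lin_comb d u y i)\<^sup>2)\<bar>
                 \<le> m * (2 * \<epsilon>) * (\<Sum>i<n1 * n2. (lin_comb d u y i)\<^sup>2)"
      proof (rule subspace_embedding_of_grid[OF u])
        fix z w assume "z \<in> grid d" "w = lin_comb d u (\<lambda>k. real_of_int (z k) / (6 * sqrt d))"
        then show "\<bar>(\<Sum>l<m. (\<Sum>i<n1 * n2. r l $ i * w i)\<^sup>2) - m * (\<Sum>i<n1 * n2. (w i)\<^sup>2)\<bar>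
            \<le> m * \<epsilon> * (\<Sum>i<n1 * n2. (w i)\<^sup>2)"
          using not_bad unfolding bad_def v_def[symmetric] by (auto simp: not_less)
      qed (use assms in simp)
      then show False using y by simp
    qed
  qed
  then have "measure_pmf.prob ?P (- ?G) \<le> measure_pmf.prob ?P (\<Union>z\<in>grid d. bad z)"
    by (intro measure_pmf.finite_measure_mono) auto
  also have "\<dots> \<le> (\<Sum>z\<in>grid d. measure_pmf.prob ?P (bad z))"
    by (intro measure_pmf.finite_measure_subadditive_finite finite_grid) auto
  also have "\<dots> \<le> (\<Sum>z\<in>grid d. 200000 * exp (- k))"
    unfolding bad_def by (intro sum_mono kronecker_rows_concentration assms)
  also have "\<dots> \<le> 192 ^ d * (200000 * exp (- k))"
    using card_grid_le[of d] by simp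
  finally show ?thesis
    using measure_pmf.prob_compl[of ?G ?P] by (simp add: Compl_eq_Diff_UNIV)
qed

section \<open>Least squares residuals\<close>

lemma lin_comb_sum:
  assumes "\<And>j. j \<in> J \<Longrightarrow> \<exists>y. \<forall>i<n. f j i = lin_comb d u y i"
  shows "\<exists>y. \<forall>i<n. (\<Sum>j\<in>J. c j * f j i) = lin_comb d u y i"
proof -
  have "\<forall>j. \<exists>y. j \<in> J \<longrightarrow> (\<forall>i<n. f j i = lin_comb d u y i)" using assms by blast
  from choice[OF this] obtain Y where Y: "\<And>j i. j \<in> J \<Longrightarrow> i < n \<Longrightarrow> f j i = lin_comb d u (Y j) i"
    by blast
  have "(\<Sum>j\<in>J. c j * f j i) = lin_comb d u (\<lambda>k. \<Sum>j\<in>J. c j * Y j k) i" if "i < n" for i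
  proof -
    have "(\<Sum>j\<in>J. c j * f j i) = (\<Sum>j\<in>J. \<Sum>k<d. c j * Y j k * u k i)"
      by (intro sum.cong refl) (simp add: Y[OF _ that] lin_comb_def sum_distrib_left mult.assoc)
    also have "\<dots> = lin_comb d u (\<lambda>k. \<Sum>j\<in>J. c j * Y j k) i"
      unfolding lin_comb_def sum_distrib_right by (rule sum.swap)
    finally show ?thesis .
  qed
  then show ?thesis by blast
qed

text \<open>
  A maximal linearly independent set of columns spans all of them.
\<close>
lemma (in vec_space) cols_in_span_of_rank_many:
  assumes "A \<in> carrier_mat n nc"
  shows "\<exists>S. finite S \<and> card S = rank A \<and> S \<subseteq> carrier_vec n \<and> set (cols A) \<subseteq> span S"
proof -
  have cols: "set (cols A) \<subseteq> carrier_vec n" using cols_dim assms by blast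
  obtain S where S: "maximal S (\<lambda>T. T \<subseteq> set (cols A) \<and> lin_indpt T)" "finite S"
    using maximal_exists_superset[of "set (cols A)" "\<lambda>T. T \<subseteq> set (cols A) \<and> lin_indpt T" "{}"]
    by (auto simp: finite_lin_indpt2)
  then have sub: "S \<subseteq> set (cols A)" "lin_indpt S" by (auto simp: maximal_def)
  have "c \<in> span S" if c: "c \<in> set (cols A)" for c
  proof (rule ccontr)
    assume "c \<notin> span S"
    moreover have "c \<notin> S" using \<open>c \<notin> span S\<close> sub cols span_mem[of S c] by auto
    ultimately have "lin_indpt (S \<union> {c})"
      using lin_dep_iff_in_span[of S c] sub cols c by auto
    then have "S \<union> {c} = S"
      using S(1) c sub(1) unfolding maximal_def by (metis Un_subset_iff Un_upper1 empty_subsetI insert_subset)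
    then show False using \<open>c \<notin> S\<close> by auto
  qed
  then show ?thesis using S sub cols rank_card_indpt[OF assms S(1)] by (intro exI[of _ S]) auto
qed

text \<open>
  The residuals lie in the span of a column basis and \<open>b\<close>, which accounts for the 1 in the dimension.
\<close>
lemma residuals_in_small_subspace:
  fixes A :: "real mat"
  assumes A: "A \<in> carrier_mat n p" and b: "b \<in> carrier_vec n"
  shows "\<exists>d\<le>vec_space.rank n A + 1. \<exists>u. orthonormal n d u \<and>
           (\<forall>x\<in>carrier_vec p. \<exists>y. \<forall>i<n. (A *\<^sub>v x - b) $ i = lin_comb d u y i)"
proof -
  interpret vec_space "TYPE(real)" n .
  obtain S where S: "finite S" "card S = rank A" "S \<subseteq> carrier_vec n" "set (cols A) \<subseteq> span S"
    using cols_in_span_of_rank_many[OF A] by blast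
  obtain ss where ss: "set ss = S" "length ss = rank A"
    using S(1,2) by (metis distinct_card finite_distinct_list)
  define v where "v j i = (ss @ [b]) ! j $ i" for j i
  obtain d u where d: "d \<le> rank A + 1" and u: "orthonormal n d u"
    and span: "\<And>j. j < rank A + 1 \<Longrightarrow> \<exists>y. \<forall>i<n. v j i = lin_comb d u y i"
    using gram_schmidt_exists[of "rank A + 1" n v] by blast
  have spanS: "\<exists>y. \<forall>i<n. w $ i = lin_comb d u y i" if w: "w \<in> S" for w
  proof -
    obtain j where "j < length ss" "w = ss ! j" using w ss(1) by (auto simp: in_set_conv_nth)
    then show ?thesis using span[of j] ss(2) by (simp add: v_def nth_append)
  qed
  have spanb: "\<exists>y. \<forall>i<n. b $ i = lin_comb d u y i"
    using span[of "rank A"] ss(2) by (simp add: v_def nth_append)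
  have spancol: "\<exists>y. \<forall>i<n. A $$ (i, j) = lin_comb d u y i" if j: "j < p" for j
  proof -
    have "Matrix.col A j \<in> span S" using S(4) j A by (auto simp: cols_def)
    then obtain a where a: "Matrix.col A j = lincomb a S"
      using finite_span[OF S(1)] S(3) by auto
    have "A $$ (i, j) = (\<Sum>w\<in>S. a w * w $ i)" if "i < n" for i
      using lincomb_index[OF that S(3), of a] a that j A by (metis carrier_matD index_col)
    then show ?thesis using lin_comb_sum[of S n "\<lambda>w i. w $ i" d u a] spanS by auto
  qed
  have "\<exists>y. \<forall>i<n. (A *\<^sub>v x - b) $ i = lin_comb d u y i" if x: "x \<in> carrier_vec p" for x
  proof -
    obtain y1 where y1: "\<And>i. i < n \<Longrightarrow> (\<Sum>j<p. x $ j * A $$ (i, j)) = lin_comb d u y1 i"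
      using lin_comb_sum[of "{..<p}" n "\<lambda>j i. A $$ (i, j)" d u "\<lambda>j. x $ j"] spancol by auto
    obtain y2 where y2: "\<And>i. i < n \<Longrightarrow> b $ i = lin_comb d u y2 i" using spanb by auto
    have "(A *\<^sub>v x - b) $ i = lin_comb d u (\<lambda>k. y1 k - y2 k) i" if i: "i < n" for i
    proof -
      have "(A *\<^sub>v x - b) $ i = (\<Sum>j<p. x $ j * A $$ (i, j)) - b $ i"
        using i x A b by (simp add: scalar_prod_def lessThan_atLeast0 mult.commute)
      then show ?thesis
        unfolding y1[OF i] y2[OF i] by (simp add: lin_comb_def left_diff_distrib sum_subtractf)
    qed
    then show ?thesis by blast
  qed
  then show ?thesis using d u by blast
qed

lemma vec_norm2_square: "(vec_norm2 w)\<^sup>2 = (\<Sum>i<dim_vec w. (w $ i)\<^sup>2)"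
  by (simp add: vec_norm2_def L2_set_def sum_nonneg)

lemma sketched_norm_square:
  assumes "w \<in> carrier_vec n"
  shows "(vec_norm2 (mat_of_rows n (map r [0..<m]) *\<^sub>v w))\<^sup>2 = (\<Sum>l<m. (\<Sum>i<n. r l $ i * w $ i)\<^sup>2)"
proof -
  let ?S = "mat_of_rows n (map r [0..<m])"
  have dim: "dim_row ?S = m" "dim_col ?S = n" by (simp_all add: mat_of_rows_def)
  have entry: "?S $$ (l, i) = r l $ i" if "l < m" "i < n" for l i
    using that by (simp add: mat_of_rows_index)
  have "(?S *\<^sub>v w) $ l = (\<Sum>i<n. r l $ i * w $ i)" if l: "l < m" for l
  proof -
    have "(?S *\<^sub>v w) $ l = Matrix.row ?S l \<bullet> w" using l dim by (intro index_mult_mat_vec) simp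
    also have "\<dots> = (\<Sum>i<n. r l $ i * w $ i)"
      unfolding scalar_prod_def lessThan_atLeast0 carrier_vecD[OF assms]
      using l dim by (intro sum.cong refl) (simp add: entry)
    finally show ?thesis .
  qed
  then show ?thesis
    unfolding vec_norm2_square dim_mult_mat_vec dim by (intro sum.cong refl) simp
qed

lemma sketched_residual:
  fixes S A :: "real mat"
  assumes "S \<in> carrier_mat m n" "A \<in> carrier_mat n p" "b \<in> carrier_vec n" "x \<in> carrier_vec p"
  shows "S * A *\<^sub>v x - S *\<^sub>v b = S *\<^sub>v (A *\<^sub>v x - b)"
  using assms by (simp add: assoc_mult_mat_vec mult_minus_distrib_mat_vec)

text \<open>
  Optimality of \<open>xhat\<close> for the sketched problem is used once, against the competitor \<open>xstar\<close>:
  \<open>(1 - \<epsilon> / 2) \<parallel>A xhat - b\<parallel>\<^sup>2 \<mu> \<le> \<parallel>S (A xhat - b)\<parallel>\<^sup>2 \<le> \<parallel>S (A xstar - b)\<parallel>\<^sup>2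
  \<le> (1 + \<epsilon> / 2) \<parallel>A xstar - b\<parallel>\<^sup>2 \<mu>\<close>.
\<close>
lemma least_squares_of_embedding:
  fixes A S :: "real mat" and \<epsilon> \<mu> :: real
  assumes A: "A \<in> carrier_mat n p" and b: "b \<in> carrier_vec n" and S: "S \<in> carrier_mat m n"
    and "0 < \<epsilon>" "\<epsilon> < 1" "\<mu> > 0"
    and embed: "\<And>x. x \<in> carrier_vec p \<Longrightarrow>
      \<bar>(vec_norm2 (S *\<^sub>v (A *\<^sub>v x - b)))\<^sup>2 - \<mu> * (vec_norm2 (A *\<^sub>v x - b))\<^sup>2\<bar>
        \<le> \<mu> * (\<epsilon> / 2) * (vec_norm2 (A *\<^sub>v x - b))\<^sup>2"
    and xhat: "least_squares_solution p (S * A) (S *\<^sub>v b) xhat" and xstar: "xstar \<in> carrier_vec p"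
  shows "(vec_norm2 (A *\<^sub>v xhat - b))\<^sup>2 \<le> (1 + \<epsilon>)\<^sup>2 * (vec_norm2 (A *\<^sub>v xstar - b))\<^sup>2"
proof -
  have xhat': "xhat \<in> carrier_vec p"
    using xhat by (simp add: least_squares_solution_def is_arg_min_def)
  have "(vec_norm2 (S * A *\<^sub>v xhat - S *\<^sub>v b))\<^sup>2 \<le> (vec_norm2 (S * A *\<^sub>v xstar - S *\<^sub>v b))\<^sup>2"
    using xhat xstar unfolding least_squares_solution_def is_arg_min_def by force
  then have opt: "(vec_norm2 (S *\<^sub>v (A *\<^sub>v xhat - b)))\<^sup>2 \<le> (vec_norm2 (S *\<^sub>v (A *\<^sub>v xstar - b)))\<^sup>2"
    by (simp only: sketched_residual[OF S A b xhat'] sketched_residual[OF S A b xstar])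
  define h s where "h = (vec_norm2 (A *\<^sub>v xhat - b))\<^sup>2" and "s = (vec_norm2 (A *\<^sub>v xstar - b))\<^sup>2"
  have "\<mu> * h - \<mu> * (\<epsilon> / 2) * h \<le> \<mu> * s + \<mu> * (\<epsilon> / 2) * s"
    using embed[OF xhat'] embed[OF xstar] opt unfolding h_def s_def by linarith
  then have "\<mu> * ((1 - \<epsilon> / 2) * h) \<le> \<mu> * ((1 + \<epsilon> / 2) * s)" by (simp add: algebra_simps)
  then have "(1 - \<epsilon> / 2) * h \<le> (1 + \<epsilon> / 2) * s" using \<open>\<mu> > 0\<close> by simp
  also have "\<dots> \<le> ((1 - \<epsilon> / 2) * (1 + \<epsilon>)\<^sup>2) * s"
  proof (rule mult_right_mono)
    have "\<epsilon> ^ 3 \<le> \<epsilon>"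
      using assms(4,5) power_decreasing[of 1 3 \<epsilon>] by simp
    then show "1 + \<epsilon> / 2 \<le> (1 - \<epsilon> / 2) * (1 + \<epsilon>)\<^sup>2"
      using assms(4) by (simp add: power2_eq_square power3_eq_cube algebra_simps)
  qed (simp add: s_def)
  finally have "(1 - \<epsilon> / 2) * h \<le> (1 - \<epsilon> / 2) * ((1 + \<epsilon>)\<^sup>2 * s)" by (simp only: mult.assoc)
  then have "h \<le> (1 + \<epsilon>)\<^sup>2 * s" using assms(5) by simp
  then show ?thesis unfolding h_def s_def .
qed

section \<open>The sample size\<close>

text \<open>
  The tail parameter \<open>20 + 6 r + 2 L\<close> pays \<open>6 (r + 1)\<close> for the \<open>192\<^sup>d\<close> points of the net, \<open>14\<close> for the
  factor \<open>200000\<close>, and leaves \<open>2 L\<close>, so that the failure probability is at most \<open>\<delta>\<^sup>2\<close> for \<open>L = ln (1 / \<delta>)\<close>.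
\<close>
lemma failure_probability_le:
  fixes L :: real
  assumes "d \<le> r + 1"
  shows "192 ^ d * (200000 * exp (- (20 + 6 * real r + 2 * L))) \<le> exp (- 2 * L)"
proof -
  have e: "5 / 2 \<le> exp (1 :: real)"
    using exp_lower_Taylor_quadratic[of "1 :: real"] by simp
  have pow: "(5 / 2) ^ n \<le> exp (real n)" for n
    using power_mono[OF e, of n] by (simp add: exp_of_nat_mult[symmetric])
  have "192 \<le> (5 / 2 :: real) ^ 6" by (simp add: power_divide)
  then have "192 \<le> exp (6 :: real)" using pow[of 6] by (simp only: of_nat_numeral)
  then have "192 ^ d \<le> exp (6 :: real) ^ d" by (intro power_mono) auto
  also have "\<dots> = exp (6 * real d)" by (simp add: exp_of_nat_mult[symmetric] mult.commute)
  also have "\<dots> \<le> exp (6 * real r + 6)" using assms by simp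
  finally have card: "192 ^ d \<le> exp (6 * real r + 6)" .
  have "200000 \<le> (5 / 2 :: real) ^ 14" by (simp add: power_divide)
  then have "200000 \<le> exp (14 :: real)" using pow[of 14] by (simp only: of_nat_numeral)
  with card have "192 ^ d * (200000 * exp (- (20 + 6 * real r + 2 * L)))
      \<le> exp (6 * real r + 6) * (exp 14 * exp (- (20 + 6 * real r + 2 * L)))"
    by (intro mult_mono) auto
  also have "\<dots> = exp (- 2 * L)" by (simp add: exp_add[symmetric])
  finally show ?thesis .
qed

text \<open>
  The first term of the maximum pays for the quadratic condition on the tail parameter and the second
  one for the linear condition, at the distortion \<open>\<epsilon> / 4\<close> that the net doubles to \<open>\<epsilon> / 2\<close>.
  The constant has to be at least \<open>400000 * 16 * 42\<close> for the latter and \<open>64 * 4 * 3528\<close> for the former.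
\<close>
lemma sample_size_bounds:
  fixes R L \<epsilon> m :: real
  assumes "R \<ge> 0" "L \<ge> 1 / 2" "0 < \<epsilon>" "\<epsilon> < 1"
    and m: "10^9 * max ((R\<^sup>2 + L\<^sup>2) / \<epsilon>) ((R + L) / \<epsilon>\<^sup>2) \<le> m"
  defines "k \<equiv> 20 + 6 * R + 2 * L"
  shows "64 * k\<^sup>2 \<le> m * (\<epsilon> / 4)" "400000 * k \<le> m * (\<epsilon> / 4)\<^sup>2"
proof -
  \<comment> \<open>The bound \<open>L \<ge> 1 / 2\<close> absorbs the additive constant: \<open>20 \<le> 40 L\<close>.\<close>
  have k: "0 \<le> k" "k \<le> 42 * (R + L)" using assms(1,2) by (simp_all add: k_def)
  have "k\<^sup>2 \<le> (42 * (R + L))\<^sup>2" using k by (intro power_mono) auto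
  also have "\<dots> \<le> 3528 * (R\<^sup>2 + L\<^sup>2)"
    using zero_le_power2[of "R - L"] by (simp add: power2_eq_square algebra_simps)
  finally have k2: "k\<^sup>2 \<le> 3528 * (R\<^sup>2 + L\<^sup>2)" .
  have "10^9 * ((R\<^sup>2 + L\<^sup>2) / \<epsilon>) \<le> m" by (rule order_trans[OF mult_left_mono m]) auto
  then have "10^9 * (R\<^sup>2 + L\<^sup>2) \<le> m * \<epsilon>" using assms(3) by (simp add: field_simps)
  have "256 * k\<^sup>2 \<le> 903168 * (R\<^sup>2 + L\<^sup>2)" using k2 by simp
  also have "\<dots> \<le> 10^9 * (R\<^sup>2 + L\<^sup>2)" by (intro mult_right_mono) auto
  also have "\<dots> \<le> m * \<epsilon>" by fact
  finally show "64 * k\<^sup>2 \<le> m * (\<epsilon> / 4)" by simp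
  have "10^9 * ((R + L) / \<epsilon>\<^sup>2) \<le> m" by (rule order_trans[OF mult_left_mono m]) auto
  then have "10^9 * (R + L) \<le> m * \<epsilon>\<^sup>2" using assms(3) by (simp add: field_simps)
  then show "400000 * k \<le> m * (\<epsilon> / 4)\<^sup>2" using k(2) assms(1,2) by (simp add: power_divide field_simps)
qed

theorem theorem1p1:
  shows "\<exists>C::real. C > 0 \<and>
    (\<forall>(n1::nat) (n2::nat) (p::nat) (m::nat) (A::real mat) (b::real vec) (xstar::real vec)
       (\<epsilon>::real) (\<delta>::real).
       n1 > 0 \<longrightarrow> n2 > 0 \<longrightarrow> p > 0 \<longrightarrow> m > 0 \<longrightarrow>
       A \<in> carrier_mat (n1 * n2) p \<longrightarrow> b \<in> carrier_vec (n1 * n2) \<longrightarrow>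
       least_squares_solution p A b xstar \<longrightarrow>
       0 < \<epsilon> \<longrightarrow> \<epsilon> < 1 \<longrightarrow> 0 < \<delta> \<longrightarrow> \<delta> < 1 / 2 \<longrightarrow>
       real m \<ge> C * max
         (((real (vec_space.rank (n1 * n2) A))\<^sup>2 + (ln (1 / \<delta>))\<^sup>2) / \<epsilon>)
         ((real (vec_space.rank (n1 * n2) A) + ln (1 / \<delta>)) / \<epsilon>\<^sup>2) \<longrightarrow>
       measure_pmf.prob (kronecker_sketch_pmf m n1 n2)
         {S. \<forall>xhat. least_squares_solution p (S * A) (S *\<^sub>v b) xhat \<longrightarrow>
               (vec_norm2 (A *\<^sub>v xhat - b))\<^sup>2
                 \<le> (1 + \<epsilon>)\<^sup>2 * (vec_norm2 (A *\<^sub>v xstar - b))\<^sup>2}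
         > 1 - \<delta>)"
proof (intro exI[of _ "10^9"] conjI allI impI)
  fix n1 n2 p m :: nat and A :: "real mat" and b xstar :: "real vec" and \<epsilon> \<delta> :: real
  assume "m > 0" and A: "A \<in> carrier_mat (n1 * n2) p" and b: "b \<in> carrier_vec (n1 * n2)"
    and "least_squares_solution p A b xstar"
    and \<epsilon>: "0 < \<epsilon>" "\<epsilon> < 1" and \<delta>: "0 < \<delta>" "\<delta> < 1 / 2"
    and m: "real m \<ge> 10^9 * max
         (((real (vec_space.rank (n1 * n2) A))\<^sup>2 + (ln (1 / \<delta>))\<^sup>2) / \<epsilon>)
         ((real (vec_space.rank (n1 * n2) A) + ln (1 / \<delta>)) / \<epsilon>\<^sup>2)"
  have xstar: "xstar \<in> carrier_vec p"
    using \<open>least_squares_solution p A b xstar\<close> by (simp add: least_squares_solution_def is_arg_min_def)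
  define N where "N = n1 * n2"
  define r where "r = vec_space.rank N A"
  define L where "L = ln (1 / \<delta>)"
  define k where "k = 20 + 6 * real r + 2 * L"
  have "ln 2 \<le> L" using \<delta> unfolding L_def by (intro ln_mono) (auto simp: field_simps)
  then have L: "1 / 2 \<le> L" using ln2_ge_two_thirds by linarith
  have "k \<ge> 1" using L by (simp add: k_def)
  have bounds: "64 * k\<^sup>2 \<le> m * (\<epsilon> / 4)" "400000 * k \<le> m * (\<epsilon> / 4)\<^sup>2"
    using sample_size_bounds[of "real r" L \<epsilon> "real m"] m \<epsilon> L
    unfolding k_def L_def r_def N_def by auto
  obtain d u where d: "d \<le> r + 1" and u: "orthonormal N d u"
    and res: "\<And>x. x \<in> carrier_vec p \<Longrightarrow> \<exists>y. \<forall>i<N. (A *\<^sub>v x - b) $ i = lin_comb d u y i"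
    using residuals_in_small_subspace[OF A b] unfolding r_def N_def by blast
  let ?P = "Pi_pmf {..<m} (0\<^sub>v N) (\<lambda>_. kronecker_row_pmf n1 n2)"
  let ?S = "\<lambda>f. mat_of_rows N (map f [0..<m])"
  let ?good = "{S. \<forall>xhat. least_squares_solution p (S * A) (S *\<^sub>v b) xhat \<longrightarrow>
               (vec_norm2 (A *\<^sub>v xhat - b))\<^sup>2 \<le> (1 + \<epsilon>)\<^sup>2 * (vec_norm2 (A *\<^sub>v xstar - b))\<^sup>2}"
  define G where "G = {f. \<forall>y. \<bar>(\<Sum>l<m. (\<Sum>i<N. f l $ i * lin_comb d u y i)\<^sup>2)
                     - m * (\<Sum>i<N. (lin_comb d u y i)\<^sup>2)\<bar>
                 \<le> m * (2 * (\<epsilon> / 4)) * (\<Sum>i<N. (lin_comb d u y i)\<^sup>2)}"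
  have sub: "G \<subseteq> ?S -` ?good"
  proof
    fix f assume f: "f \<in> G"
    have S: "?S f \<in> carrier_mat m N" by (simp add: mat_of_rows_def)
    have embed: "\<bar>(vec_norm2 (?S f *\<^sub>v (A *\<^sub>v x - b)))\<^sup>2 - m * (vec_norm2 (A *\<^sub>v x - b))\<^sup>2\<bar>
        \<le> m * (\<epsilon> / 2) * (vec_norm2 (A *\<^sub>v x - b))\<^sup>2" if x: "x \<in> carrier_vec p" for x
    proof -
      obtain y where y: "\<And>i. i < N \<Longrightarrow> (A *\<^sub>v x - b) $ i = lin_comb d u y i" using res[OF x] by blast
      have w: "A *\<^sub>v x - b \<in> carrier_vec N" using A b x by (simp add: N_def)
      have "(vec_norm2 (A *\<^sub>v x - b))\<^sup>2 = (\<Sum>i<N. (lin_comb d u y i)\<^sup>2)"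
        unfolding vec_norm2_square carrier_vecD[OF w] using y by (intro sum.cong) auto
      moreover have "(vec_norm2 (?S f *\<^sub>v (A *\<^sub>v x - b)))\<^sup>2 = (\<Sum>l<m. (\<Sum>i<N. f l $ i * lin_comb d u y i)\<^sup>2)"
        unfolding sketched_norm_square[OF w] using y by simp
      ultimately show ?thesis using f unfolding G_def by simp
    qed
    show "f \<in> ?S -` ?good"
      using least_squares_of_embedding[OF A[folded N_def] b[folded N_def] S \<epsilon> _ embed _ xstar] \<open>m > 0\<close>
      by auto
  qed
  have "\<delta> = exp (- L)" using \<delta> by (simp add: L_def ln_div)
  then have "1 - \<delta> < 1 - exp (- 2 * L)" using L by simp
  also have "\<dots> \<le> 1 - 192 ^ d * (200000 * exp (- k))"
    using failure_probability_le[OF d, of L] unfolding k_def by simp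
  also have "\<dots> \<le> measure_pmf.prob ?P G"
    unfolding G_def N_def
    by (rule kronecker_subspace_embedding[OF _ \<open>k \<ge> 1\<close> bounds u[unfolded N_def]]) (use \<epsilon> in simp)
  also have "\<dots> \<le> measure_pmf.prob ?P (?S -` ?good)"
    by (intro measure_pmf.finite_measure_mono sub) simp
  also have "\<dots> = measure_pmf.prob (kronecker_sketch_pmf m n1 n2) ?good"
    unfolding kronecker_sketch_pmf_def N_def by simp
  finally show "1 - \<delta> < measure_pmf.prob (kronecker_sketch_pmf m n1 n2) ?good" .
qed simp

end
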